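(* Let $N\in\mathbb{N}$, $\tau>0$, and let $U^0\in\mathbb{R}^N_+$ be some nonnegative initial datum satisfying $h\sum_{i=0}^{N-1}U_i^0=1$. Consider the discrete variational derivative (DVD) scheme, with unknowns $V_i^{k+1}=\sqrt{U_i^{k+1}}$, $$\frac1\tau\left(V_i^{k+1}-V_i^k\right)=\frac{1}{2W_i^{k+1/2}}\,\delta_i^+\!\left(W_i^{k+1/2}W_{i-1}^{k+1/2}\,\delta_i^-\!\left(\delta\mathcal{F}_{\mathrm d}(W^{k+1/2})_i\right)\right)-\frac{\delta}{2}\,\delta_i^{\langle1\rangle}\!\left(W_i^{k+1/2}\,\delta\mathcal{F}_{\mathrm d}(W^{k+1/2})_i\right)$$ for all $i=0,\dots,N-1$, $k\ge0$, where $W^{k+1/2}=(V^{k+1}+V^k)/2$. The scheme is consistent of order $O(\tau)+O(h^2)$ with respect to the time-space discretization; solutions $U^k$, $k\ge1$, are nonnegative by construction and satisfy $h\sum_{i=0}^{N-1}U_i^k=1$; and the discrete Fisher information is nonincreasing, i.e. $\mathcal{F}_{\mathrm d}(U^{k+1})\le\mathcal{F}_{\mathrm d}(U^k)$ for all $k\ge0$. Furthermore, there exists a constant $C>0$, independent of $\tau$ and $h$, such that $$h\sum_{i=0}^{N-1}\left(\sqrt{u_i^k}-\sqrt{U_i^k}\right)^2\le C\,\frac{\tau^2+h^4}{1-\tau}\qquad\text{for all }k\ge1,$$ where $u^k\in\mathbb{R}^N$ represents the values, at the grid points and at time $t_k=k\tau$, of sufficiently smooth solutions $u$ to $$\partial_t\sqrt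 u=\frac{1}{2\sqrt u}\left(u\left(\mathcal{F}'(u)\right)_x\right)_x-\frac{\delta}{2}\left(\sqrt u\,\mathcal{F}'(u)\right)_x,\qquad \mathcal{F}'(u)=-\frac{(\sqrt u)_{xx}}{\sqrt u}.$$
   Context: $\mathbb{T}\cong[0,1)$ is the one-dimensional torus (periodic boundary conditions), with equidistant grid $\{x_i : i=0,\dots,N\}$, $x_0\cong x_N$, of mesh size $h$ (so $h=1/N$); indices are understood periodically modulo $N$. The vector $U^k\in\mathbb{R}^N$, with components $U_i^k$, $i=0,\dots,N-1$, approximates the values $u(t_k,x_i)$ at times $t_k=k\tau$, where $\tau$ is the time step; correspondingly $u_i^k=u(t_k,x_i)$ and $V_i^k=\sqrt{U_i^k}$. The constant $\delta$ is the parameter of the equation displayed in the claim, which is, for smooth positive solutions, an equivalent form of the corrected Derrida-Lebowitz-Speer-Spohn equation $\partial_t u=-\frac12\left(u(\log u)_{xx}\right)_{xx}+2\delta\left(u^{3/4}(u^{1/4})_{xx}\right)_x$ on $\mathbb{T}$. $\mathcal{F}'(u)$ is the variational derivative of the Fisher information $\mathcal{F}(u)=\int_{\mathbb{T}}(\sqrt u)_x^2\,dx$. Finite difference operators, for $U\in\mathbb{R}^N$: $\delta_i^+U=h^{-1}(U_{i+1}-U_i)$, $\delta_i^-U=h^{-1}(U_i-U_{i-1})$, $\delta_i^{\langle1\rangle}U=(2h)^{-1}(U_{i+1}-U_{i-1})$, $\delta_i^{\langle2\rangle}U=\delta_i^+\delta_i^-U=h^{-2}(U_{i+1}-2U_i+U_{i-1})$.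 Applied to an expression depending on $i$, they act on the vector whose $i$-th component is that expression. The discrete Fisher information is $$\mathcal{F}_{\mathrm d}(U)=\frac12\sum_{i=0}^{N-1}\left((\delta_i^+V)^2+(\delta_i^-V)^2\right)h,\qquad V_i=\sqrt{U_i},$$ and its discrete variational derivative is $\delta\mathcal{F}_{\mathrm d}(W)_i=-\delta_i^{\langle2\rangle}W/W_i$ (here the prefix $\delta$ is part of the notation and is not the parameter $\delta$). Consistency of order $O(\tau)+O(h^2)$ refers to the order of the local truncation error of the scheme for a sufficiently smooth solution $u$, i.e. the residual obtained when $V_i^k$ is replaced in the scheme by $\sqrt{u(t_k,x_i)}$.
   Formalization: The error estimate assumes τ<1 (its right side is negative or undefined otherwise) and that the squared initial error between U^0 and u(0,·) is at most C_0(τ²+h⁴), without which it is false; u is positive with bounded derivatives, and k ranges over times t_k where u exists. *)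

theory Defs
  imports "HOL-Analysis.Analysis"
begin

section \<open>Periodic grid functions and difference operators\<close>

text \<open>
  A vector in \<open>\<real>\<^sup>N\<close> is a function on \<open>nat\<close> of which only the values at \<open>i < N\<close> are used. The mesh size
  is \<open>h = 1/N\<close>, and neighbouring indices are taken modulo \<open>N\<close>. Everything is meant for \<open>N > 0\<close>.
\<close>

definition mesh :: "nat \<Rightarrow> real" where
  "mesh N = 1 / real N"

definition nxt :: "nat \<Rightarrow> nat \<Rightarrow> nat" where
  "nxt N i = (i + 1) mod N"

definition prv :: "nat \<Rightarrow> nat \<Rightarrow> nat" where
  "prv N i = (i + (N - 1)) mod N"

definition dplus :: "nat \<Rightarrow> (nat \<Rightarrow> real) \<Rightarrow> nat \<Rightarrow> real" where
  "dplus N U i = (U (nxt N i) - U i) / mesh N"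

definition dminus :: "nat \<Rightarrow> (nat \<Rightarrow> real) \<Rightarrow> nat \<Rightarrow> real" where
  "dminus N U i = (U i - U (prv N i)) / mesh N"

definition dcentral :: "nat \<Rightarrow> (nat \<Rightarrow> real) \<Rightarrow> nat \<Rightarrow> real" where
  "dcentral N U i = (U (nxt N i) - U (prv N i)) / (2 * mesh N)"

definition dsecond :: "nat \<Rightarrow> (nat \<Rightarrow> real) \<Rightarrow> nat \<Rightarrow> real" where
  "dsecond N U i = dplus N (dminus N U) i"

lemma prv_nxt: "i < N \<Longrightarrow> prv N (nxt N i) = i"
  by (cases "Suc i = N") (auto simp: prv_def nxt_def)

lemma nxt_prv: "i < N \<Longrightarrow> nxt N (prv N i) = i"
  by (cases i) (auto simp: prv_def nxt_def mod_Suc)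

lemma dsecond_eq:
  assumes "i < N"
  shows "dsecond N U i = (U (nxt N i) - 2 * U i + U (prv N i)) / (mesh N)\<^sup>2"
  using assms
  by (simp add: dsecond_def dplus_def dminus_def prv_nxt power2_eq_square diff_divide_distrib
      add_divide_distrib)

definition dmass :: "nat \<Rightarrow> (nat \<Rightarrow> real) \<Rightarrow> real" where
  "dmass N U = mesh N * (\<Sum>i<N. U i)"

definition dfisher :: "nat \<Rightarrow> (nat \<Rightarrow> real) \<Rightarrow> real" where
  "dfisher N U =
     (let V = (\<lambda>i. sqrt (U i))
      in 1/2 * (\<Sum>i<N. ((dplus N V i)\<^sup>2 + (dminus N V i)\<^sup>2) * mesh N))"

definition dfisher_deriv :: "nat \<Rightarrow> (nat \<Rightarrow> real) \<Rightarrow> nat \<Rightarrow> real" where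
  "dfisher_deriv N W i = - dsecond N W i / W i"

section \<open>The DVD scheme\<close>

definition dvd_rhs :: "real \<Rightarrow> nat \<Rightarrow> (nat \<Rightarrow> real) \<Rightarrow> nat \<Rightarrow> real" where
  "dvd_rhs \<delta> N W i =
     1 / (2 * W i) * dplus N (\<lambda>j. W j * W (prv N j) * dminus N (dfisher_deriv N W) j) i
     - \<delta> / 2 * dcentral N (\<lambda>j. W j * dfisher_deriv N W j) i"

definition midpoint :: "(nat \<Rightarrow> real) \<Rightarrow> (nat \<Rightarrow> real) \<Rightarrow> nat \<Rightarrow> real" where
  "midpoint V V' i = (V' i + V i) / 2"

definition dvd_residual ::
    "real \<Rightarrow> nat \<Rightarrow> real \<Rightarrow> (nat \<Rightarrow> real) \<Rightarrow> (nat \<Rightarrow> real) \<Rightarrow> nat \<Rightarrow> real" where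
  "dvd_residual \<delta> N \<tau> V V' i = 1/\<tau> * (V' i - V i) - dvd_rhs \<delta> N (midpoint V V') i"

text \<open>
  The first condition says that \<open>V k i\<close> is the square root of \<open>U k i\<close> (HOL's \<open>sqrt\<close> is extended to
  negative numbers as an odd function, so the equation \<open>V k i = sqrt (U k i)\<close> alone would not say so).
  The condition \<open>midpoint \<noteq> 0\<close> expresses that the quotients in the scheme are meaningful; without it,
  HOL's convention \<open>x / 0 = 0\<close> would admit spurious solutions. Zeros of \<open>U k\<close> itself are allowed.
\<close>

definition dvd_solution ::
    "real \<Rightarrow> nat \<Rightarrow> real \<Rightarrow> (nat \<Rightarrow> nat \<Rightarrow> real) \<Rightarrow> (nat \<Rightarrow> nat \<Rightarrow> real) \<Rightarrow> bool" where
  "dvd_solution \<delta> N \<tau> U V \<longleftrightarrow>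
     (\<forall>k. \<forall>i<N. 0 \<le> V k i \<and> (V k i)\<^sup>2 = U k i) \<and>
     (\<forall>k. \<forall>i<N. midpoint (V k) (V (Suc k)) i \<noteq> 0 \<and>
        1/\<tau> * (V (Suc k) i - V k i) = dvd_rhs \<delta> N (midpoint (V k) (V (Suc k))) i)"

definition initial_datum :: "nat \<Rightarrow> (nat \<Rightarrow> real) \<Rightarrow> bool" where
  "initial_datum N U0 \<longleftrightarrow> (\<forall>i<N. 0 \<le> U0 i) \<and> dmass N U0 = 1"

section \<open>Smooth solutions of the differential equation\<close>

text \<open>A solution lives either on a compact time interval or on the whole half-line.\<close>

definition time_interval :: "real set \<Rightarrow> bool" where
  "time_interval I \<longleftrightarrow> I = {0..} \<or> (\<exists>T>0. I = {0..T})"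

definition bounded_continuous :: "real set \<Rightarrow> (real \<Rightarrow> real \<Rightarrow> real) \<Rightarrow> bool" where
  "bounded_continuous I f \<longleftrightarrow>
     continuous_on (I \<times> UNIV) (\<lambda>(t, x). f t x) \<and> bounded ((\<lambda>(t, x). f t x) ` (I \<times> UNIV))"

text \<open>
  \<open>smooth_upto I n f\<close>: all partial derivatives of \<open>f\<close> in \<open>(t, x) \<in> I \<times> \<real>\<close> of total order at most \<open>n\<close>
  exist and are continuous and bounded (one-sided in time at the end points of \<open>I\<close>). For functions
  that are periodic in \<open>x\<close> and a compact \<open>I\<close>, boundedness is automatic.
\<close>

primrec smooth_upto :: "real set \<Rightarrow> nat \<Rightarrow> (real \<Rightarrow> real \<Rightarrow> real) \<Rightarrow> bool" where
  "smooth_upto I 0 f \<longleftrightarrow> bounded_continuous I f"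
| "smooth_upto I (Suc n) f \<longleftrightarrow> bounded_continuous I f \<and>
     (\<exists>ft fx. (\<forall>t\<in>I. \<forall>x. ((\<lambda>s. f s x) has_real_derivative ft t x) (at t within I) \<and>
                        (f t has_real_derivative fx t x) (at x)) \<and>
              smooth_upto I n ft \<and> smooth_upto I n fx)"

definition fisher_deriv :: "(real \<Rightarrow> real) \<Rightarrow> real \<Rightarrow> real" where
  "fisher_deriv w x = - deriv (deriv (\<lambda>y. sqrt (w y))) x / sqrt (w x)"

text \<open>Functions on the torus are 1-periodic functions on \<open>\<real>\<close>.\<close>

definition pde_solution :: "real \<Rightarrow> real set \<Rightarrow> (real \<Rightarrow> real \<Rightarrow> real) \<Rightarrow> bool" where
  "pde_solution \<delta> I u \<longleftrightarrow>
     (\<forall>t\<in>I. \<forall>x. 0 < u t x \<and> u t (x + 1) = u t x \<and>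
       ((\<lambda>s. sqrt (u s x)) has_real_derivative
          (1 / (2 * sqrt (u t x)) * deriv (\<lambda>y. u t y * deriv (fisher_deriv (u t)) y) x
           - \<delta> / 2 * deriv (\<lambda>y. sqrt (u t y) * fisher_deriv (u t) y) x)) (at t within I))"

definition grid_values ::
    "nat \<Rightarrow> real \<Rightarrow> (real \<Rightarrow> real \<Rightarrow> real) \<Rightarrow> nat \<Rightarrow> nat \<Rightarrow> real" where
  "grid_values N \<tau> u k i = u (real k * \<tau>) (real i * mesh N)"

text \<open>Squared discrete Hellinger distance.\<close>

definition dhellinger2 :: "nat \<Rightarrow> (nat \<Rightarrow> real) \<Rightarrow> (nat \<Rightarrow> real) \<Rightarrow> real" where
  "dhellinger2 N a b = mesh N * (\<Sum>i<N. (sqrt (a i) - sqrt (b i))\<^sup>2)"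

definition consistent ::
    "real \<Rightarrow> real set \<Rightarrow> (real \<Rightarrow> real \<Rightarrow> real) \<Rightarrow> bool" where
  "consistent \<delta> I u \<longleftrightarrow>
     (\<exists>C>0. \<forall>N \<tau> k i. 0 < N \<longrightarrow> 0 < \<tau> \<longrightarrow> real (Suc k) * \<tau> \<in> I \<longrightarrow> i < N \<longrightarrow>
        \<bar>dvd_residual \<delta> N \<tau> (\<lambda>j. sqrt (grid_values N \<tau> u k j))
                            (\<lambda>j. sqrt (grid_values N \<tau> u (Suc k) j)) i\<bar>
        \<le> C * (\<tau> + (mesh N)\<^sup>2))"

end

theory Submission
  imports Defs
begin

text \<open>
  Where \<open>W\<close> does not vanish, the right-hand side of the scheme is
  \<open>A W = - S S W/2 + (S W)\<^sup>2/(2W) + (\<delta>/2) C S W\<close>, where \<open>S\<close> and \<open>C\<close> are the second and the central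
  first difference. This operator is orthogonal to \<open>W\<close> (mass), has
  a nonnegative product with \<open>S W\<close> (Fisher information) and is monotone in \<open>\<ell>\<^sup>2\<close>. Monotonicity turns the
  residual \<open>r\<close> of a smooth solution into the error recursion \<open>|e'| \<le> |e| + \<tau> |r|\<close>, without any
  exponential growth and without a restriction on the mesh.

  On the half-line the residuals must be summable in time. With \<open>v = sqrt u\<close> and \<open>c\<close> the (conserved)
  quadratic mean of \<open>v\<close>, the same dissipation gives \<open>d/dt \<integral>(v - c)\<^sup>2 = - c \<integral>v\<^sub>x\<^sub>x\<^sup>2/v\<close>, hence exponential
  convergence of \<open>u\<close> to \<open>c\<^sup>2\<close>; by Landau's inequality all derivatives that occur in the residual
  decay exponentially too.
\<close>

section \<open>Discrete monotonicity and invariants\<close>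

text \<open>The obstacle on the half-line is that positivity is not known to be uniform in time at
  the outset: if \<open>u\<close> came close to zero for large times, the derivatives of
  \<open>sqrt u\<close> could be unbounded. So the energy argument runs on each
  \<open>{0..T}\<close>, where compactness gives a lower bound, but its rate \<open>c / M\<close>
  and its prefactor depend neither on \<open>T\<close> nor on that bound. It yields convergence of
  \<open>u\<close> itself, whose spatial Lipschitz constant is uniform by assumption. This
  convergence then gives the uniform lower bound, and with it the smoothness of
  \<open>sqrt u\<close> for all times. The second concern is homogeneity: the residual inherits the
  decay only if each of its terms carries a factor of the decaying bound \<open>B t\<close>. The
  spatial derivatives of \<open>sqrt u\<close> and its increments in time do, \<open>sqrt u\<close>
  itself does not, and a product of two small factors is bounded by \<open>B t\<close> times the
  initial size \<open>C\<close>.\<close>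

lemma nxt_less [simp]: "i < N \<Longrightarrow> nxt N i < N"
  by (simp add: nxt_def)

lemma prv_less [simp]: "i < N \<Longrightarrow> prv N i < N"
  by (simp add: prv_def)

section \<open>Shifts and summation by parts on the periodic grid\<close>

lemma sum_nxt: "(\<Sum>i<N. f (nxt N i)) = (\<Sum>i<N. f i)"
  by (rule sum.reindex_bij_witness[of _ "prv N" "nxt N"]) (auto simp: prv_nxt nxt_prv)

lemma sum_prv: "(\<Sum>i<N. f (prv N i)) = (\<Sum>i<N. f i)"
  by (rule sum.reindex_bij_witness[of _ "nxt N" "prv N"]) (auto simp: prv_nxt nxt_prv)

lemma sum_mult_prv: "(\<Sum>i<N. f i * g (prv N i)) = (\<Sum>i<N. f (nxt N i) * (g i :: real))"
proof -
  have "(\<Sum>i<N. f i * g (prv N i)) = (\<Sum>i<N. f (nxt N i) * g (prv N (nxt N i)))"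
    using sum_nxt[where f = "\<lambda>i. f i * g (prv N i)" and N = N] by simp
  also have "\<dots> = (\<Sum>i<N. f (nxt N i) * g i)"
    by (rule sum.cong) (auto simp: prv_nxt)
  finally show ?thesis .
qed

lemma sum_dplus_by_parts:
  "(\<Sum>i<N. f i * dplus N g i) = - (\<Sum>i<N. dminus N f i * g i)"
proof -
  have "(\<Sum>i<N. f i * dplus N g i) + (\<Sum>i<N. dminus N f i * g i)
      = ((\<Sum>i<N. g (nxt N i) * f i) - (\<Sum>i<N. g i * f (prv N i))) / mesh N"
    by (simp add: dplus_def dminus_def sum_subtractf sum_divide_distrib diff_divide_distrib
        algebra_simps flip: sum.distrib)
  then show ?thesis
    by (simp add: sum_mult_prv)
qed

lemma sum_dsecond_by_parts:
  "(\<Sum>i<N. f i * dsecond N g i) = - (\<Sum>i<N. dminus N f i * dminus N g i)"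
  unfolding dsecond_def by (rule sum_dplus_by_parts)

lemma sum_dsecond_commute:
  "(\<Sum>i<N. f i * dsecond N g i) = (\<Sum>i<N. dsecond N f i * g i)"
  using sum_dsecond_by_parts[of f N g] sum_dsecond_by_parts[of g N f]
  by (simp add: mult.commute)

text \<open>The central difference is antisymmetric, the second difference symmetric, and the two
  commute because both are translation invariant; so their product is antisymmetric and its
  quadratic form is zero. This disposes of the \<open>\<delta>\<close> term in the mass balance and
  in the monotonicity estimate.\<close>

lemma sum_dcentral_dsecond: "(\<Sum>i<N. f i * dcentral N (dsecond N f) i) = 0"
proof -
  have "(\<Sum>i<N. f i * dcentral N g i)
      = ((\<Sum>i<N. g (nxt N i) * f i) - (\<Sum>i<N. f i * g (prv N i))) / (2 * mesh N)" for g
    by (simp add: dcentral_def sum_subtractf sum_divide_distrib diff_divide_distrib algebra_simps)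
  then have "(\<Sum>i<N. f i * dcentral N (dsecond N f) i)
      = ((\<Sum>i<N. f (prv N i) * dsecond N f i) - (\<Sum>i<N. f (nxt N i) * dsecond N f i)) / (2 * mesh N)"
    using sum_mult_prv[of "dsecond N f" f N] sum_mult_prv[of f "dsecond N f" N]
    by (simp add: mult.commute)
  moreover have "(\<Sum>i<N. f (prv N i) * dsecond N f i) = (\<Sum>i<N. f (nxt N i) * dsecond N f i)"
  proof -
    \<comment> \<open>With \<open>a\<close>, \<open>b\<close>, \<open>c\<close> for the next,
      previous and central value, \<open>(a - b) (a - 2 c + b) = a\<^sup>2 - b\<^sup>2 - 2 a c + 2 c
      b\<close>; the squares and the mixed products cancel after a shift of the index.\<close>
    have "(\<Sum>i<N. f (nxt N i) * dsecond N f i) - (\<Sum>i<N. f (prv N i) * dsecond N f i)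
       = (\<Sum>i<N. (f (nxt N i))\<^sup>2 - (f (prv N i))\<^sup>2 - 2 * (f (nxt N i) * f i) + 2 * (f i * f (prv N i))) / (mesh N)\<^sup>2"
      unfolding sum_divide_distrib sum_subtractf[symmetric]
      by (rule sum.cong) (auto simp: dsecond_eq power2_eq_square algebra_simps diff_divide_distrib add_divide_distrib)
    also have "\<dots> = 0"
      using sum_nxt[where N = N and f = "\<lambda>i. (f i)\<^sup>2"] sum_prv[where N = N and f = "\<lambda>i. (f i)\<^sup>2"] sum_mult_prv[of f f N]
      by (simp add: sum.distrib sum_subtractf flip: sum_distrib_left)
    finally show ?thesis by simp
  qed
  ultimately show ?thesis by simp
qed

section \<open>Algebra of the right-hand side: mass, dissipation, monotonicity\<close>

lemma dsecond_diff: "dsecond N (\<lambda>i. f i - g i) i = dsecond N f i - dsecond N g i"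
  by (simp add: dsecond_def dplus_def dminus_def diff_divide_distrib)

lemma dcentral_diff: "dcentral N (\<lambda>i. f i - g i) i = dcentral N f i - dcentral N g i"
  by (simp add: dcentral_def diff_divide_distrib)

lemma dcentral_cong:
  "(\<And>j. j < N \<Longrightarrow> f j = g j) \<Longrightarrow> i < N \<Longrightarrow> dcentral N f i = dcentral N g i"
  by (simp add: dcentral_def)

text \<open>The mobility \<open>W j * W (prv N j)\<close> clears the denominators in the difference
  of the quotients, so that the flux becomes the discrete Wronskian of \<open>W\<close> and its
  second difference. What remains is the discrete form of
  \<open>(f' g - f g')' = f'' g - f g''\<close>.\<close>

lemma dvd_rhs_eq:
  assumes nz: "\<And>j. j < N \<Longrightarrow> W j \<noteq> 0" and i: "i < N"
  shows "dvd_rhs \<delta> N W i = - 1/2 * dsecond N (dsecond N W) i + (dsecond N W i)\<^sup>2 / (2 * W i)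
     + \<delta> / 2 * dcentral N (dsecond N W) i"
proof -
  let ?D = "dsecond N W" and ?h = "mesh N"
  let ?G = "\<lambda>j. W j * W (prv N j) * dminus N (dfisher_deriv N W) j"
  have G: "?G j = (W j * ?D (prv N j) - W (prv N j) * ?D j) / ?h" if "j < N" for j
  proof -
    have "W j \<noteq> 0" "W (prv N j) \<noteq> 0" using nz that by auto
    then have "W j * W (prv N j) * (dfisher_deriv N W j - dfisher_deriv N W (prv N j))
        = W j * ?D (prv N j) - W (prv N j) * ?D j"
      by (simp add: dfisher_deriv_def field_simps)
    then show ?thesis
      by (simp add: dminus_def)
  qed
  have Gn: "?G (nxt N i) = (W (nxt N i) * ?D i - W i * ?D (nxt N i)) / ?h"
    using G[OF nxt_less[OF i]] by (simp only: prv_nxt[OF i])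
  have Wi: "W i \<noteq> 0" using nz i by simp
  have "dplus N ?G i = (W (nxt N i) * ?D i - W i * ?D (nxt N i) - W i * ?D (prv N i) + W (prv N i) * ?D i) / ?h\<^sup>2"
    unfolding dplus_def Gn G[OF i]
    by (simp add: power2_eq_square diff_divide_distrib add_divide_distrib mult_ac)
  also have "\<dots> = ?D i * dsecond N W i - W i * dsecond N ?D i"
    using i unfolding dsecond_eq[OF i, of ?D] dsecond_eq[OF i, of W]
    by (simp add: diff_divide_distrib add_divide_distrib algebra_simps)
  finally have 1: "1 / (2 * W i) * dplus N ?G i = - 1/2 * dsecond N ?D i + (?D i)\<^sup>2 / (2 * W i)"
    using Wi by (simp add: field_simps power2_eq_square)
  have "dcentral N (\<lambda>j. W j * dfisher_deriv N W j) i = dcentral N (\<lambda>j. 0 - ?D j) i"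
    by (rule dcentral_cong) (use nz i in \<open>auto simp: dfisher_deriv_def\<close>)
  then have "dcentral N (\<lambda>j. W j * dfisher_deriv N W j) i = - dcentral N ?D i"
    by (simp only: dcentral_diff) (simp add: dcentral_def)
  with 1 show ?thesis
    unfolding dvd_rhs_def by simp
qed

text \<open>Multiplication by \<open>W\<close> removes the quotient, and by symmetry of the second
  difference the fourth-order term becomes minus half the square sum of \<open>?D\<close>, which the
  quadratic term compensates.\<close>

lemma sum_dvd_rhs_mult_self:
  assumes nz: "\<And>j. j < N \<Longrightarrow> W j \<noteq> 0"
  shows "(\<Sum>i<N. W i * dvd_rhs \<delta> N W i) = 0"
proof -
  let ?D = "dsecond N W"
  have "(\<Sum>i<N. W i * dvd_rhs \<delta> N W i)
     = (\<Sum>i<N. - 1/2 * (W i * dsecond N ?D i) + 1/2 * (?D i * ?D i) + \<delta> / 2 * (W i * dcentral N ?D i))"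
    by (rule sum.cong) (use nz in \<open>auto simp: dvd_rhs_eq power2_eq_square field_simps\<close>)
  also have "\<dots> = - 1/2 * (\<Sum>i<N. W i * dsecond N ?D i) + 1/2 * (\<Sum>i<N. ?D i * ?D i)
      + \<delta> / 2 * (\<Sum>i<N. W i * dcentral N ?D i)"
    by (simp only: sum.distrib sum_distrib_left)
  also have "\<dots> = 0"
    by (simp add: sum_dcentral_dsecond sum_dsecond_commute)
  finally show ?thesis .
qed

text \<open>Here the flux form is kept: the second difference is \<open>- W\<close> times the
  variational derivative \<open>?F\<close>, so the factor \<open>1 / W\<close> cancels, and one
  summation by parts leaves a sum of squares of \<open>dminus N ?F\<close> weighted by the positive
  mobility. The \<open>\<delta>\<close> term vanishes by antisymmetry of the central
  difference.\<close>

lemma sum_dvd_rhs_mult_dsecond_nonneg: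
  assumes pos: "\<And>j. j < N \<Longrightarrow> 0 < W j"
  shows "0 \<le> (\<Sum>i<N. dsecond N W i * dvd_rhs \<delta> N W i)"
proof -
  let ?D = "dsecond N W" and ?F = "dfisher_deriv N W"
  let ?G = "\<lambda>j. W j * W (prv N j) * dminus N ?F j"
  have "(\<Sum>i<N. ?D i * dvd_rhs \<delta> N W i)
     = (\<Sum>i<N. - 1/2 * (?F i * dplus N ?G i) + \<delta> / 2 * (?D i * dcentral N ?D i))"
  proof (rule sum.cong, goal_cases)
    case (2 i)
    then have i: "i < N" and "0 < W i" using pos by auto
    have "dcentral N (\<lambda>j. W j * ?F j) i = dcentral N (\<lambda>j. 0 - ?D j) i"
      by (rule dcentral_cong) (use pos i in \<open>fastforce simp: dfisher_deriv_def\<close>)+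
    then have "dcentral N (\<lambda>j. W j * ?F j) i = - dcentral N ?D i"
      by (simp only: dcentral_diff) (simp add: dcentral_def)
    with \<open>0 < W i\<close> show ?case
      by (simp add: dvd_rhs_def dfisher_deriv_def field_simps)
  qed simp
  also have "\<dots> = 1/2 * (\<Sum>i<N. dminus N ?F i * ?G i) + \<delta> / 2 * (\<Sum>i<N. ?D i * dcentral N ?D i)"
    by (simp only: sum.distrib flip: sum_distrib_left) (simp add: sum_dplus_by_parts)
  also have "(\<Sum>i<N. ?D i * dcentral N ?D i) = 0"
  proof -
    have "(\<Sum>i<N. f i * dcentral N f i) = 0" for f :: "nat \<Rightarrow> real"
      using sum_mult_prv[of f f N]
      by (simp add: dcentral_def right_diff_distrib diff_divide_distrib sum_subtractf mult.commute
          flip: sum_divide_distrib)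
    then show ?thesis .
  qed
  finally have "(\<Sum>i<N. ?D i * dvd_rhs \<delta> N W i)
      = 1/2 * (\<Sum>i<N. W i * W (prv N i) * (dminus N ?F i)\<^sup>2)"
    by (simp add: power2_eq_square mult_ac)
  also have "0 \<le> \<dots>"
    using pos by (intro mult_nonneg_nonneg sum_nonneg) (auto intro: less_imp_le)
  finally show ?thesis .
qed

text \<open>With \<open>d\<close>, \<open>D\<close> the second differences of \<open>w\<close>, \<open>W\<close>, the reason is the identity
  \<open>-(d - D)\<^sup>2 + (d\<^sup>2/w - D\<^sup>2/W) (w - W) = - (d W - D w)\<^sup>2 / (w W)\<close>.\<close>

lemma dvd_rhs_dissipative:
  assumes w: "\<And>j. j < N \<Longrightarrow> 0 < w j" and W: "\<And>j. j < N \<Longrightarrow> 0 < W j"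
  shows "(\<Sum>i<N. (dvd_rhs \<delta> N w i - dvd_rhs \<delta> N W i) * (w i - W i)) \<le> 0"
proof -
  define e where "e = (\<lambda>i. w i - W i)"
  let ?d = "dsecond N w" and ?D = "dsecond N W" and ?e = "dsecond N e"
  have e2: "?e = (\<lambda>i. ?d i - ?D i)"
    by (rule ext) (simp add: e_def dsecond_diff)
  have "(\<Sum>i<N. (dvd_rhs \<delta> N w i - dvd_rhs \<delta> N W i) * (w i - W i))
     = (\<Sum>i<N. - 1/2 * (e i * dsecond N ?e i) + 1/2 * ((?d i)\<^sup>2 / w i - (?D i)\<^sup>2 / W i) * e i
          + \<delta> / 2 * (e i * dcentral N ?e i))"
  proof (rule sum.cong, goal_cases)
    case (2 i)
    then have i: "i < N" by simp
    have nz: "w j \<noteq> 0" "W j \<noteq> 0" if "j < N" for j using w W that by fastforce+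
    have rw: "dvd_rhs \<delta> N w i = - 1/2 * dsecond N ?d i + 1/2 * ((?d i)\<^sup>2 / w i) + \<delta> / 2 * dcentral N ?d i"
      "dvd_rhs \<delta> N W i = - 1/2 * dsecond N ?D i + 1/2 * ((?D i)\<^sup>2 / W i) + \<delta> / 2 * dcentral N ?D i"
      using dvd_rhs_eq[of N w i \<delta>, OF nz(1) i] dvd_rhs_eq[of N W i \<delta>, OF nz(2) i] by simp_all
    show ?case
      unfolding e2 dsecond_diff dcentral_diff rw
      by (simp add: e_def left_diff_distrib right_diff_distrib diff_divide_distrib add_divide_distrib algebra_simps)
  qed simp
  also have "\<dots> = - 1/2 * (\<Sum>i<N. e i * dsecond N ?e i)
      + (\<Sum>i<N. 1/2 * ((?d i)\<^sup>2 / w i - (?D i)\<^sup>2 / W i) * e i)"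
    by (simp only: sum.distrib flip: sum_distrib_left) (simp add: sum_dcentral_dsecond)
  also have "\<dots> = (\<Sum>i<N. - 1/2 * (?e i * ?e i) + 1/2 * ((?d i)\<^sup>2 / w i - (?D i)\<^sup>2 / W i) * e i)"
    unfolding sum_dsecond_commute[of e N ?e] by (simp only: sum.distrib sum_distrib_left)
  also have "\<dots> = (\<Sum>i<N. - 1/2 * ((?d i * W i - ?D i * w i)\<^sup>2 / (w i * W i)))"
  proof (rule sum.cong, goal_cases)
    case (2 i)
    then have "0 < w i" "0 < W i" using w W by auto
    then show ?case
      unfolding e2 unfolding e_def by (simp add: field_simps power2_eq_square)
  qed simp
  also have "\<dots> \<le> 0"
    using w W by (intro sum_nonpos) (auto simp: less_imp_le)
  finally show ?thesis .
qed

section \<open>Consequences for one time step\<close>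

lemma sum_sq_dminus: "(\<Sum>i<N. (dminus N f i)\<^sup>2) = (\<Sum>i<N. (dplus N f i)\<^sup>2)"
proof -
  have "(\<Sum>i<N. (dminus N f i)\<^sup>2) = (\<Sum>i<N. (dminus N f (nxt N i))\<^sup>2)"
    by (simp add: sum_nxt[where f = "\<lambda>i. (dminus N f i)\<^sup>2"])
  also have "\<dots> = (\<Sum>i<N. (dplus N f i)\<^sup>2)"
    by (rule sum.cong) (auto simp: dplus_def dminus_def prv_nxt)
  finally show ?thesis .
qed

lemma dfisher_eq:
  assumes "\<And>i. i < N \<Longrightarrow> sqrt (U i) = V i"
  shows "dfisher N U = mesh N * (\<Sum>i<N. (dminus N V i)\<^sup>2)"
proof -
  have "dfisher N U = 1/2 * (\<Sum>i<N. ((dplus N V i)\<^sup>2 + (dminus N V i)\<^sup>2) * mesh N)"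
    unfolding dfisher_def Let_def using assms by (auto simp: dplus_def dminus_def)
  also have "\<dots> = 1/2 * mesh N * ((\<Sum>i<N. (dplus N V i)\<^sup>2) + (\<Sum>i<N. (dminus N V i)\<^sup>2))"
    by (simp add: sum_distrib_left sum.distrib algebra_simps)
  finally show ?thesis by (simp add: sum_sq_dminus)
qed

lemma dvd_solutionD:
  assumes "dvd_solution \<delta> N \<tau> U V" "i < N"
  shows "0 \<le> V k i" "(V k i)\<^sup>2 = U k i" "sqrt (U k i) = V k i" "0 < midpoint (V k) (V (Suc k)) i"
    "1/\<tau> * (V (Suc k) i - V k i) = dvd_rhs \<delta> N (midpoint (V k) (V (Suc k))) i"
proof -
  show *: "0 \<le> V k i" "(V k i)\<^sup>2 = U k i" for k
    using assms by (auto simp: dvd_solution_def)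
  then show "sqrt (U k i) = V k i"
    by (metis real_sqrt_unique)
  \<comment> \<open>\<open>V\<close> may vanish at grid points, but a nonzero mean of two
    nonnegative numbers is positive; this is the strict positivity on which monotonicity and
    dissipation rest.\<close>
  have "midpoint (V k) (V (Suc k)) i \<noteq> 0"
    using assms by (auto simp: dvd_solution_def)
  then show "0 < midpoint (V k) (V (Suc k)) i"
    using *(1)[of k] *(1)[of "Suc k"] by (auto simp: midpoint_def)
  show "1/\<tau> * (V (Suc k) i - V k i) = dvd_rhs \<delta> N (midpoint (V k) (V (Suc k))) i"
    using assms by (auto simp: dvd_solution_def)
qed

text \<open>\<open>U' - U = (V' - V) (V' + V)\<close>, and the last factor is twice the midpoint at
  which the scheme evaluates its right-hand side. So the change of mass is a multiple of a pairing
  that vanishes.\<close>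

lemma dmass_step:
  assumes sol: "dvd_solution \<delta> N \<tau> U V" and "0 < \<tau>"
  shows "dmass N (U (Suc k)) = dmass N (U k)"
proof -
  let ?W = "midpoint (V k) (V (Suc k))"
  have "(\<Sum>i<N. U (Suc k) i - U k i) = (\<Sum>i<N. 2 * \<tau> * (?W i * dvd_rhs \<delta> N ?W i))"
  proof (rule sum.cong, goal_cases)
    case (2 i)
    then have i: "i < N" by simp
    show ?case
      unfolding dvd_solutionD(2)[OF sol i, symmetric] dvd_solutionD(5)[OF sol i, symmetric]
      using \<open>0 < \<tau>\<close> by (simp add: midpoint_def power2_eq_square field_simps)
  qed simp
  also have "\<dots> = 2 * \<tau> * (\<Sum>i<N. ?W i * dvd_rhs \<delta> N ?W i)"
    by (simp add: sum_distrib_left)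
  also have "\<dots> = 0"
    using sum_dvd_rhs_mult_self[of N ?W \<delta>] dvd_solutionD(4)[OF sol] by (metis less_numeral_extra(3) mult_zero_right)
  finally show ?thesis
    by (simp add: dmass_def sum_subtractf)
qed

text \<open>A quadratic form \<open>q\<close> with polar form \<open>b\<close> satisfies
  \<open>q V' - q V = 2 b (V' - V, W)\<close> at the midpoint \<open>W\<close>. Summation by parts
  moves both differences to \<open>W\<close>, which leads to the pairing with the second difference;
  no time discretization error enters.\<close>

lemma dfisher_step:
  assumes sol: "dvd_solution \<delta> N \<tau> U V" and "0 < \<tau>"
  shows "dfisher N (U (Suc k)) \<le> dfisher N (U k)"
proof -
  let ?W = "midpoint (V k) (V (Suc k))" and ?e = "\<lambda>i. V (Suc k) i - V k i"
  have "(\<Sum>i<N. (dminus N (V (Suc k)) i)\<^sup>2) - (\<Sum>i<N. (dminus N (V k) i)\<^sup>2)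
      = (\<Sum>i<N. 2 * (dminus N ?e i * dminus N ?W i))"
    unfolding sum_subtractf[symmetric]
    by (rule sum.cong) (auto simp: dminus_def midpoint_def power2_eq_square
        diff_divide_distrib add_divide_distrib algebra_simps)
  also have "\<dots> = - 2 * (\<Sum>i<N. ?e i * dsecond N ?W i)"
    by (simp add: sum_dsecond_by_parts sum_distrib_left sum_negf)
  also have "(\<Sum>i<N. ?e i * dsecond N ?W i) = (\<Sum>i<N. \<tau> * (dsecond N ?W i * dvd_rhs \<delta> N ?W i))"
  proof (rule sum.cong, goal_cases)
    case (2 i)
    then have i: "i < N" by simp
    show ?case
      unfolding dvd_solutionD(5)[OF sol i, symmetric] using \<open>0 < \<tau>\<close> by simp
  qed simp
  also have "\<dots> = \<tau> * (\<Sum>i<N. dsecond N ?W i * dvd_rhs \<delta> N ?W i)"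
    by (simp add: sum_distrib_left)
  finally have "(\<Sum>i<N. (dminus N (V (Suc k)) i)\<^sup>2) - (\<Sum>i<N. (dminus N (V k) i)\<^sup>2) \<le> 0"
    using sum_dvd_rhs_mult_dsecond_nonneg[of N ?W \<delta>, OF dvd_solutionD(4)[OF sol]] \<open>0 < \<tau>\<close>
    by (simp add: mult_nonneg_nonneg)
  moreover have "0 \<le> mesh N" by (simp add: mesh_def)
  ultimately show ?thesis
    using dvd_solutionD(3)[OF sol] by (simp add: dfisher_eq mult_left_mono)
qed

text \<open>The sum \<open>e' + e\<close> is twice the difference of the two midpoints, so testing
  the error equation with it meets the monotonicity of the right-hand side without remainder. Only
  the residual is left; after Cauchy-Schwarz and the triangle inequality the factor
  \<open>?n' + ?n\<close> cancels on both sides.\<close>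

lemma dvd_error_step:
  assumes V: "\<And>i. i < N \<Longrightarrow> 0 < midpoint V V' i"
    and step: "\<And>i. i < N \<Longrightarrow> dvd_residual \<delta> N \<tau> V V' i = 0"
    and v: "\<And>i. i < N \<Longrightarrow> 0 < midpoint v v' i"
    and \<tau>: "0 < \<tau>"
  shows "L2_set (\<lambda>i. v' i - V' i) {..<N}
    \<le> L2_set (\<lambda>i. v i - V i) {..<N} + \<tau> * L2_set (dvd_residual \<delta> N \<tau> v v') {..<N}"
proof -
  let ?w = "midpoint v v'" and ?W = "midpoint V V'"
  let ?e = "\<lambda>i. v i - V i" and ?e' = "\<lambda>i. v' i - V' i"
  let ?r = "dvd_residual \<delta> N \<tau> v v'"
  let ?n = "L2_set ?e {..<N}" and ?n' = "L2_set ?e' {..<N}" and ?R = "L2_set ?r {..<N}"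
  have "?n'\<^sup>2 - ?n\<^sup>2 = (\<Sum>i<N. (?e' i)\<^sup>2 - (?e i)\<^sup>2)"
    by (simp add: L2_set_def sum_nonneg sum_subtractf)
  also have "\<dots> = (\<Sum>i<N. 2 * \<tau> * ((dvd_rhs \<delta> N ?w i - dvd_rhs \<delta> N ?W i) * (?w i - ?W i))
       + \<tau> * (?r i * (?e' i + ?e i)))"
  proof (rule sum.cong, goal_cases)
    case (2 i)
    then have i: "i < N" by simp
    have 1: "V' i = V i + \<tau> * dvd_rhs \<delta> N ?W i"
      using step[OF i] \<tau> by (simp add: dvd_residual_def field_simps)
    have 2: "v' i = v i + \<tau> * (dvd_rhs \<delta> N ?w i + ?r i)"
      using \<tau> by (simp add: dvd_residual_def field_simps)
    have mid: "?w i - ?W i = (?e' i + ?e i) / 2"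
      by (simp add: midpoint_def field_simps)
    have "(?e' i)\<^sup>2 - (?e i)\<^sup>2 = (?e' i - ?e i) * (?e' i + ?e i)"
      by (simp add: power2_eq_square algebra_simps)
    also have "?e' i - ?e i = \<tau> * (dvd_rhs \<delta> N ?w i - dvd_rhs \<delta> N ?W i + ?r i)"
      using 1 2 by (simp add: algebra_simps)
    finally show ?case
      unfolding mid by (simp only: distrib_left distrib_right) (simp add: field_simps)
  qed simp
  also have "\<dots> = 2 * \<tau> * (\<Sum>i<N. (dvd_rhs \<delta> N ?w i - dvd_rhs \<delta> N ?W i) * (?w i - ?W i))
       + \<tau> * (\<Sum>i<N. ?r i * (?e' i + ?e i))"
    by (simp only: sum.distrib sum_distrib_left)
  also have "\<dots> \<le> \<tau> * (\<Sum>i<N. ?r i * (?e' i + ?e i))"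
    using dvd_rhs_dissipative[of N ?w ?W \<delta>, OF v V] \<tau> by (simp add: mult_nonneg_nonpos)
  also have "\<dots> \<le> \<tau> * (?R * (?n' + ?n))"
  proof (rule mult_left_mono)
    have "(\<Sum>i<N. ?r i * (?e' i + ?e i)) \<le> (\<Sum>i<N. \<bar>?r i\<bar> * \<bar>?e' i + ?e i\<bar>)"
      by (rule sum_mono) (simp flip: abs_mult)
    also have "\<dots> \<le> ?R * L2_set (\<lambda>i. ?e' i + ?e i) {..<N}"
      by (rule L2_set_mult_ineq)
    also have "\<dots> \<le> ?R * (?n' + ?n)"
      by (intro mult_left_mono L2_set_triangle_ineq L2_set_nonneg)
    finally show "(\<Sum>i<N. ?r i * (?e' i + ?e i)) \<le> ?R * (?n' + ?n)" .
  qed (use \<tau> in simp)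
  finally have "(?n' - ?n) * (?n' + ?n) \<le> (\<tau> * ?R) * (?n' + ?n)"
    by (simp add: power2_eq_square algebra_simps)
  moreover have "0 \<le> ?n" "0 \<le> ?n'" "0 \<le> \<tau> * ?R"
    using \<tau> by auto
  ultimately show ?thesis
    by (cases "?n' + ?n = 0") (simp_all add: add_nonneg_eq_0_iff mult_le_cancel_right)
qed

lemma dhellinger2_eq:
  assumes "\<And>i. i < N \<Longrightarrow> sqrt (a i) = v i" "\<And>i. i < N \<Longrightarrow> sqrt (b i) = V i"
  shows "dhellinger2 N a b = mesh N * (L2_set (\<lambda>i. v i - V i) {..<N})\<^sup>2"
  using assms by (simp add: dhellinger2_def L2_set_def sum_nonneg)

section \<open>Finite difference stencils\<close>

text \<open>Two applications of the mean value theorem, hence \<open>K\<close> instead of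
  \<open>K / 2\<close>. Derivatives are taken within \<open>S\<close> to admit the end points of a
  time interval, and \<open>K\<close> bounds \<open>f''\<close> only to the right of
  \<open>a\<close> because it will be a decreasing function of time evaluated at
  \<open>a\<close>.\<close>

lemma taylor1_bound:
  fixes f :: "real \<Rightarrow> real"
  assumes S: "convex S" and ab: "a \<in> S" "b \<in> S" "a \<le> b"
    and f: "\<And>s. s \<in> S \<Longrightarrow> (f has_real_derivative f' s) (at s within S)"
    and f': "\<And>s. s \<in> S \<Longrightarrow> (f' has_real_derivative f'' s) (at s within S)"
    and K: "\<And>s. s \<in> S \<Longrightarrow> a \<le> s \<Longrightarrow> \<bar>f'' s\<bar> \<le> K"
  shows "\<bar>f b - f a - (b - a) * f' a\<bar> \<le> K * (b - a)\<^sup>2"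
proof -
  have sub: "{a..b} \<subseteq> S"
    using S ab by (metis atLeastAtMost_iff closed_segment_eq_real_ivl closed_segment_subset subsetI)
  have "0 \<le> K" using K[OF ab(1)] by simp
  have 1: "norm (f' s - f' a) \<le> K * norm (s - a)" if "s \<in> {a..b}" for s
    by (rule field_differentiable_bound[of "{a..b}" f' f''])
      (use sub K that ab in \<open>auto intro!: DERIV_subset[OF f'] simp: subset_iff\<close>)
  have "norm ((f b - b * f' a) - (f a - a * f' a)) \<le> (K * (b - a)) * norm (b - a)"
  proof (rule field_differentiable_bound[of "{a..b}" _ "\<lambda>s. f' s - f' a"])
    fix s assume s: "s \<in> {a..b}"
    have "(f has_real_derivative f' s) (at s within {a..b})"
      using sub s by (auto intro!: DERIV_subset[OF f])
    then show "((\<lambda>s. f s - s * f' a) has_real_derivative f' s - f' a) (at s within {a..b})"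
      by (auto intro!: derivative_eq_intros)
    have "norm (f' s - f' a) \<le> K * norm (s - a)" by (rule 1) fact
    also have "\<dots> \<le> K * (b - a)"
      using s \<open>0 \<le> K\<close> by (intro mult_left_mono) auto
    finally show "norm (f' s - f' a) \<le> K * (b - a)" .
  qed (use ab in auto)
  then show ?thesis
    using ab by (simp add: power2_eq_square algebra_simps)
qed

text \<open>The grid differences as operators on functions of a real variable: there they can be
  differentiated, on which the treatment of nested differences relies.\<close>

definition cdiff :: "real \<Rightarrow> (real \<Rightarrow> real) \<Rightarrow> real \<Rightarrow> real" where
  "cdiff h f x = (f (x + h) - f (x - h)) / (2 * h)"

definition cdiff2 :: "real \<Rightarrow> (real \<Rightarrow> real) \<Rightarrow> real \<Rightarrow> real" where
  "cdiff2 h f x = (f (x + h) - 2 * f x + f (x - h)) / h\<^sup>2"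

text \<open>All stencil estimates come from the mean value theorem: a function that vanishes at \<open>0\<close>
  and whose derivative is at most \<open>K s\<^sup>n\<close> is at most \<open>K s\<^sup>n\<^sup>+\<^sup>1\<close>.\<close>

lemma mvt_power_bound:
  fixes p :: "real \<Rightarrow> real"
  assumes "\<And>s. (p has_real_derivative p' s) (at s)" "p 0 = 0"
    and "\<And>s. 0 \<le> s \<Longrightarrow> \<bar>p' s\<bar> \<le> K * s ^ n" and "0 \<le> s"
  shows "\<bar>p s\<bar> \<le> K * s ^ Suc n"
proof -
  have "0 \<le> K" using assms(3)[of 1] by simp
  have "norm (p s - p 0) \<le> (K * s ^ n) * norm (s - 0)"
  proof (rule field_differentiable_bound[of "{0..s}" p p'])
    fix r assume r: "r \<in> {0..s}"
    show "(p has_real_derivative p' r) (at r within {0..s})"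
      by (rule has_field_derivative_at_within) (rule assms)
    have "\<bar>p' r\<bar> \<le> K * r ^ n" using r assms by simp
    also have "\<dots> \<le> K * s ^ n" using r \<open>0 \<le> K\<close> by (intro mult_left_mono power_mono) auto
    finally show "norm (p' r) \<le> K * s ^ n" by simp
  qed (use assms in auto)
  then show ?thesis using assms by (simp add: mult_ac)
qed

lemma DERIV_plus_minus:
  fixes f :: "real \<Rightarrow> real"
  assumes "\<And>x. (f has_real_derivative f' x) (at x)"
  shows "((\<lambda>s. f (x + s)) has_real_derivative f' (x + s)) (at s)"
    and "((\<lambda>s. f (x - s)) has_real_derivative - f' (x - s)) (at s)"
proof -
  have "((\<lambda>s. f (x + s)) has_real_derivative f' (x + s) * 1) (at s)"
    by (rule DERIV_chain2[OF assms]) (auto intro!: derivative_eq_intros)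
  then show "((\<lambda>s. f (x + s)) has_real_derivative f' (x + s)) (at s)" by simp
  have "((\<lambda>s. f (x - s)) has_real_derivative f' (x - s) * (- 1)) (at s)"
    by (rule DERIV_chain2[OF assms]) (auto intro!: derivative_eq_intros)
  then show "((\<lambda>s. f (x - s)) has_real_derivative - f' (x - s)) (at s)" by simp
qed

text \<open>Differences commute with derivatives. So the error of a nested difference splits into
  two errors of single ones, the first of them for the function \<open>cdiff2 h f\<close>, whose
  derivatives are differences of the derivatives of \<open>f\<close>.\<close>

lemma cdiff2_has_derivative:
  assumes "\<And>x. (f has_real_derivative f' x) (at x)"
  shows "(cdiff2 h f has_real_derivative cdiff2 h f' x) (at x)"
proof -
  have "((\<lambda>x. f (x + h)) has_real_derivative f' (x + h)) (at x)"
    "((\<lambda>x. f (x - h)) has_real_derivative f' (x - h)) (at x)"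
    using DERIV_shift[of f "f' (x + h)" x h] DERIV_shift[of f "f' (x - h)" x "-h"] assms by auto
  then show ?thesis
    unfolding cdiff2_def[abs_def]
    by (intro DERIV_cdivide DERIV_add DERIV_diff DERIV_cmult assms)
qed

lemma odd_part_bound:
  fixes f :: "real \<Rightarrow> real"
  assumes d: "\<And>x. (f has_real_derivative f' x) (at x)" and B: "\<And>x. \<bar>f' x\<bar> \<le> B" and "0 \<le> s"
  shows "\<bar>f (x + s) - f (x - s)\<bar> \<le> 2 * B * s"
proof -
  have "\<bar>f (x + s) - f (x - s)\<bar> \<le> (2 * B) * s ^ Suc 0"
  proof (rule mvt_power_bound[where p' = "\<lambda>s. f' (x + s) + f' (x - s)"])
    show "((\<lambda>s. f (x + s) - f (x - s)) has_real_derivative f' (x + s) + f' (x - s)) (at s)" for s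
      by (auto intro!: derivative_eq_intros DERIV_plus_minus[OF d])
    show "\<bar>f' (x + s) + f' (x - s)\<bar> \<le> 2 * B * s ^ 0" for s
      using B[of "x + s"] B[of "x - s"] by simp
  qed (use assms in auto)
  then show ?thesis by simp
qed

lemma even_part_bound:
  fixes f :: "real \<Rightarrow> real"
  assumes d: "\<And>x. (f has_real_derivative f' x) (at x)" "\<And>x. (f' has_real_derivative f'' x) (at x)"
    and B: "\<And>x. \<bar>f'' x\<bar> \<le> B" and "0 \<le> s"
  shows "\<bar>f (x + s) - 2 * f x + f (x - s)\<bar> \<le> 2 * B * s\<^sup>2"
proof -
  have "\<bar>f (x + s) - 2 * f x + f (x - s)\<bar> \<le> (2 * B) * s ^ Suc 1"
  proof (rule mvt_power_bound[where p' = "\<lambda>s. f' (x + s) - f' (x - s)"])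
    show "((\<lambda>s. f (x + s) - 2 * f x + f (x - s)) has_real_derivative f' (x + s) - f' (x - s)) (at s)" for s
      by (auto intro!: derivative_eq_intros DERIV_plus_minus[OF d(1)])
    show "\<bar>f' (x + s) - f' (x - s)\<bar> \<le> 2 * B * s ^ 1" if "0 \<le> s" for s
      using odd_part_bound[OF d(2) B that] by simp
  qed (use assms in auto)
  then show ?thesis by (simp add: power2_eq_square)
qed

lemma cdiff2_bound:
  assumes "\<And>x. (f has_real_derivative f' x) (at x)" "\<And>x. (f' has_real_derivative f'' x) (at x)"
    and "\<And>x. \<bar>f'' x\<bar> \<le> B" and "0 < h"
  shows "\<bar>cdiff2 h f x\<bar> \<le> 2 * B"
  using even_part_bound[OF assms(1-3), of h x] \<open>0 < h\<close>
  by (simp add: cdiff2_def abs_divide divide_le_eq)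

text \<open>As a function of the step width, the remainder has as its derivative the remainder of
  the odd difference of \<open>f1\<close>; the derivative of that one is the second difference of
  \<open>f2\<close>, which \<open>f4\<close> controls. The constant is 2 rather than 1/12 because
  the powers of the step are bounded, not integrated.\<close>

lemma cdiff2_error:
  assumes d: "\<And>x. (f has_real_derivative f1 x) (at x)" "\<And>x. (f1 has_real_derivative f2 x) (at x)"
      "\<And>x. (f2 has_real_derivative f3 x) (at x)" "\<And>x. (f3 has_real_derivative f4 x) (at x)"
    and B: "\<And>x. \<bar>f4 x\<bar> \<le> B" and h: "0 < h"
  shows "\<bar>cdiff2 h f x - f2 x\<bar> \<le> 2 * B * h\<^sup>2"
proof -
  have 1: "\<bar>f1 (x + s) - f1 (x - s) - 2 * s * f2 x\<bar> \<le> (2 * B) * s ^ Suc 2" if "0 \<le> s" for s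
  proof (rule mvt_power_bound[where p' = "\<lambda>s. f2 (x + s) - 2 * f2 x + f2 (x - s)"])
    show "((\<lambda>s. f1 (x + s) - f1 (x - s) - 2 * s * f2 x) has_real_derivative f2 (x + s) - 2 * f2 x + f2 (x - s)) (at s)" for s
      by (auto intro!: derivative_eq_intros DERIV_plus_minus[OF d(2)])
    show "\<bar>f2 (x + s) - 2 * f2 x + f2 (x - s)\<bar> \<le> 2 * B * s\<^sup>2" if "0 \<le> s" for s
      by (rule even_part_bound[OF d(3,4) B that])
  qed (use that in auto)
  have "\<bar>f (x + h) - 2 * f x + f (x - h) - h\<^sup>2 * f2 x\<bar> \<le> (2 * B) * h ^ Suc 3"
  proof (rule mvt_power_bound[where p' = "\<lambda>s. f1 (x + s) - f1 (x - s) - 2 * s * f2 x"])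
    show "((\<lambda>s. f (x + s) - 2 * f x + f (x - s) - s\<^sup>2 * f2 x) has_real_derivative f1 (x + s) - f1 (x - s) - 2 * s * f2 x) (at s)" for s
      by (auto intro!: derivative_eq_intros DERIV_plus_minus[OF d(1)])
    show "\<bar>f1 (x + s) - f1 (x - s) - 2 * s * f2 x\<bar> \<le> 2 * B * s ^ 3" if "0 \<le> s" for s
      using 1[OF that] by (simp add: eval_nat_numeral)
  qed (use h in auto)
  moreover have "cdiff2 h f x - f2 x = (f (x + h) - 2 * f x + f (x - h) - h\<^sup>2 * f2 x) / h\<^sup>2"
    using h by (simp add: cdiff2_def diff_divide_distrib)
  ultimately show ?thesis
    using h by (simp add: abs_divide divide_le_eq eval_nat_numeral mult_ac)
qed

lemma cdiff_error:
  assumes d: "\<And>x. (f has_real_derivative f1 x) (at x)" "\<And>x. (f1 has_real_derivative f2 x) (at x)"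
      "\<And>x. (f2 has_real_derivative f3 x) (at x)"
    and B: "\<And>x. \<bar>f3 x\<bar> \<le> B" and h: "0 < h"
  shows "\<bar>cdiff h f x - f1 x\<bar> \<le> B * h\<^sup>2"
proof -
  have "\<bar>f (x + h) - f (x - h) - 2 * h * f1 x\<bar> \<le> (2 * B) * h ^ Suc 2"
  proof (rule mvt_power_bound[where p' = "\<lambda>s. f1 (x + s) - 2 * f1 x + f1 (x - s)"])
    show "((\<lambda>s. f (x + s) - f (x - s) - 2 * s * f1 x) has_real_derivative f1 (x + s) - 2 * f1 x + f1 (x - s)) (at s)" for s
      by (auto intro!: derivative_eq_intros DERIV_plus_minus[OF d(1)])
    show "\<bar>f1 (x + s) - 2 * f1 x + f1 (x - s)\<bar> \<le> 2 * B * s\<^sup>2" if "0 \<le> s" for s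
      by (rule even_part_bound[OF d(2,3) B that])
  qed (use h in auto)
  moreover have "cdiff h f x - f1 x = (f (x + h) - f (x - h) - 2 * h * f1 x) / (2 * h)"
    using h by (simp add: cdiff_def diff_divide_distrib)
  ultimately show ?thesis
    using h by (simp add: abs_divide divide_le_eq eval_nat_numeral mult_ac)
qed

section \<open>Smooth functions of time and space\<close>

lemma bounded_continuous_iff:
  "bounded_continuous I f \<longleftrightarrow>
    continuous_on (I \<times> UNIV) (\<lambda>(t, x). f t x) \<and> (\<exists>K. \<forall>t\<in>I. \<forall>x. \<bar>f t x\<bar> \<le> K)"
  unfolding bounded_continuous_def bounded_iff by auto

lemma bounded_continuous_const: "bounded_continuous I (\<lambda>_ _. c)"
  by (auto simp: bounded_continuous_iff)

lemma bounded_continuous_add: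
  assumes "bounded_continuous I f" "bounded_continuous I g"
  shows "bounded_continuous I (\<lambda>t x. f t x + g t x)"
proof -
  obtain K L where "\<forall>t\<in>I. \<forall>x. \<bar>f t x\<bar> \<le> K" "\<forall>t\<in>I. \<forall>x. \<bar>g t x\<bar> \<le> L"
    using assms by (auto simp: bounded_continuous_iff)
  then have "\<forall>t\<in>I. \<forall>x. \<bar>f t x + g t x\<bar> \<le> K + L"
    by (metis abs_triangle_ineq add_mono order_trans)
  then show ?thesis
    using assms unfolding bounded_continuous_iff by (auto simp: case_prod_beta intro!: continuous_intros)
qed

lemma bounded_continuous_mult:
  assumes "bounded_continuous I f" "bounded_continuous I g"
  shows "bounded_continuous I (\<lambda>t x. f t x * g t x)"
proof -
  obtain K L where "\<forall>t\<in>I. \<forall>x. \<bar>f t x\<bar> \<le> K" "\<forall>t\<in>I. \<forall>x. \<bar>g t x\<bar> \<le> L"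
    using assms by (auto simp: bounded_continuous_iff)
  then have "\<forall>t\<in>I. \<forall>x. \<bar>f t x * g t x\<bar> \<le> K * L"
    unfolding abs_mult by (meson abs_ge_zero mult_mono order_trans)
  then show ?thesis
    using assms unfolding bounded_continuous_iff by (auto simp: case_prod_beta intro!: continuous_intros)
qed

lemma bounded_continuous_powr:
  assumes "bounded_continuous I f" and "0 < \<epsilon>" "\<And>t x. t \<in> I \<Longrightarrow> \<epsilon> \<le> f t x"
  shows "bounded_continuous I (\<lambda>t x. f t x powr a)"
proof -
  obtain K where K: "\<And>t x. t \<in> I \<Longrightarrow> \<bar>f t x\<bar> \<le> K"
    using assms(1) unfolding bounded_continuous_iff by blast
  \<comment> \<open>The two summands serve the two signs of the exponent: the upper bound of
    \<open>f\<close> matters for \<open>a \<ge> 0\<close>, the lower bound for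
    \<open>a < 0\<close>.\<close>
  have "f t x powr a \<le> K powr a + \<epsilon> powr a" if "t \<in> I" for t x
  proof (cases "a \<ge> 0")
    case True
    then have "f t x powr a \<le> K powr a"
      using assms(2) assms(3)[OF that, of x] K[OF that, of x] by (intro powr_mono2) auto
    then show ?thesis by (simp add: add_increasing2)
  next
    case False
    then have "f t x powr a \<le> \<epsilon> powr a"
      using assms(2) assms(3)[OF that, of x] by (intro powr_mono2') auto
    then show ?thesis by (simp add: add_increasing)
  qed
  moreover have "continuous_on (I \<times> UNIV) (\<lambda>(t, x). f t x powr a)"
  proof -
    have "f t x \<noteq> 0" if "t \<in> I" for t x
      using assms(2) assms(3)[OF that, of x] by auto
    then show ?thesis
      using assms(1) unfolding bounded_continuous_iff
      by (auto simp: case_prod_beta intro!: continuous_on_powr continuous_on_const)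
  qed
  ultimately show ?thesis
    unfolding bounded_continuous_iff by auto
qed

lemma smooth_upto_imp_bounded_continuous:
  "smooth_upto I n f \<Longrightarrow> bounded_continuous I f"
  by (cases n) auto

lemma smooth_upto_SucE:
  assumes "smooth_upto I (Suc n) f"
  obtains ft fx where
    "\<And>t x. t \<in> I \<Longrightarrow> ((\<lambda>s. f s x) has_real_derivative ft t x) (at t within I)"
    "\<And>t x. t \<in> I \<Longrightarrow> (f t has_real_derivative fx t x) (at x)"
    "smooth_upto I n ft" "smooth_upto I n fx"
  using assms unfolding smooth_upto.simps by blast

lemma smooth_upto_SucI:
  assumes "bounded_continuous I f"
    "\<And>t x. t \<in> I \<Longrightarrow> ((\<lambda>s. f s x) has_real_derivative ft t x) (at t within I)"
    "\<And>t x. t \<in> I \<Longrightarrow> (f t has_real_derivative fx t x) (at x)"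
    "smooth_upto I n ft" "smooth_upto I n fx"
  shows "smooth_upto I (Suc n) f"
  using assms unfolding smooth_upto.simps by blast

lemma smooth_upto_Suc_imp: "smooth_upto I (Suc n) f \<Longrightarrow> smooth_upto I n f"
proof (induction n arbitrary: f)
  case 0
  then show ?case by simp
next
  case (Suc n)
  obtain ft fx where
    "\<And>t x. t \<in> I \<Longrightarrow> ((\<lambda>s. f s x) has_real_derivative ft t x) (at t within I)"
    "\<And>t x. t \<in> I \<Longrightarrow> (f t has_real_derivative fx t x) (at x)"
    "smooth_upto I (Suc n) ft" "smooth_upto I (Suc n) fx"
    using Suc.prems by (rule smooth_upto_SucE) blast
  note f = this
  show ?case
    by (rule smooth_upto_SucI[OF smooth_upto_imp_bounded_continuous[OF Suc.prems] f(1,2)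
          Suc.IH[OF f(3)] Suc.IH[OF f(4)]])
qed

lemma smooth_upto_const: "smooth_upto I n (\<lambda>_ _. c)"
proof (induction n arbitrary: c)
  case (Suc n)
  show ?case
    by (rule smooth_upto_SucI[OF bounded_continuous_const DERIV_const DERIV_const Suc.IH Suc.IH])
qed (simp add: bounded_continuous_const)

lemma smooth_upto_add:
  "smooth_upto I n f \<Longrightarrow> smooth_upto I n g \<Longrightarrow> smooth_upto I n (\<lambda>t x. f t x + g t x)"
proof (induction n arbitrary: f g)
  case 0
  then show ?case by (simp add: bounded_continuous_add)
next
  case (Suc n)
  obtain ft fx where f:
    "\<And>t x. t \<in> I \<Longrightarrow> ((\<lambda>s. f s x) has_real_derivative ft t x) (at t within I)"
    "\<And>t x. t \<in> I \<Longrightarrow> (f t has_real_derivative fx t x) (at x)"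
    "smooth_upto I n ft" "smooth_upto I n fx"
    using Suc.prems(1) by (rule smooth_upto_SucE) blast
  obtain gt gx where g:
    "\<And>t x. t \<in> I \<Longrightarrow> ((\<lambda>s. g s x) has_real_derivative gt t x) (at t within I)"
    "\<And>t x. t \<in> I \<Longrightarrow> (g t has_real_derivative gx t x) (at x)"
    "smooth_upto I n gt" "smooth_upto I n gx"
    using Suc.prems(2) by (rule smooth_upto_SucE) blast
  note bc = Suc.prems[THEN smooth_upto_imp_bounded_continuous]
  show ?case
    by (rule smooth_upto_SucI[OF bounded_continuous_add[OF bc] DERIV_add[OF f(1) g(1)]
          DERIV_add[OF f(2) g(2)] Suc.IH[OF f(3) g(3)] Suc.IH[OF f(4) g(4)]])
qed

lemma smooth_upto_mult:
  "smooth_upto I n f \<Longrightarrow> smooth_upto I n g \<Longrightarrow> smooth_upto I n (\<lambda>t x. f t x * g t x)"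
proof (induction n arbitrary: f g)
  case 0
  then show ?case by (simp add: bounded_continuous_mult)
next
  case (Suc n)
  obtain ft fx where f:
    "\<And>t x. t \<in> I \<Longrightarrow> ((\<lambda>s. f s x) has_real_derivative ft t x) (at t within I)"
    "\<And>t x. t \<in> I \<Longrightarrow> (f t has_real_derivative fx t x) (at x)"
    "smooth_upto I n ft" "smooth_upto I n fx"
    using Suc.prems(1) by (rule smooth_upto_SucE) blast
  obtain gt gx where g:
    "\<And>t x. t \<in> I \<Longrightarrow> ((\<lambda>s. g s x) has_real_derivative gt t x) (at t within I)"
    "\<And>t x. t \<in> I \<Longrightarrow> (g t has_real_derivative gx t x) (at x)"
    "smooth_upto I n gt" "smooth_upto I n gx"
    using Suc.prems(2) by (rule smooth_upto_SucE) blast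
  have lower: "smooth_upto I n f" "smooth_upto I n g"
    by (rule Suc.prems[THEN smooth_upto_Suc_imp])+
  note bc = Suc.prems[THEN smooth_upto_imp_bounded_continuous]
  show ?case
  proof (rule smooth_upto_SucI)
    show "bounded_continuous I (\<lambda>t x. f t x * g t x)"
      by (rule bounded_continuous_mult[OF bc])
    show "((\<lambda>s. f s x * g s x) has_real_derivative ft t x * g t x + gt t x * f t x) (at t within I)"
      if "t \<in> I" for t x
      by (rule DERIV_mult[OF f(1)[OF that] g(1)[OF that]])
    show "((\<lambda>y. f t y * g t y) has_real_derivative fx t x * g t x + gx t x * f t x) (at x)"
      if "t \<in> I" for t x
      by (rule DERIV_mult[OF f(2)[OF that] g(2)[OF that]])
    show "smooth_upto I n (\<lambda>t x. ft t x * g t x + gt t x * f t x)"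
      by (rule smooth_upto_add[OF Suc.IH[OF f(3) lower(2)] Suc.IH[OF g(3) lower(1)]])
    show "smooth_upto I n (\<lambda>t x. fx t x * g t x + gx t x * f t x)"
      by (rule smooth_upto_add[OF Suc.IH[OF f(4) lower(2)] Suc.IH[OF g(4) lower(1)]])
  qed
qed

text \<open>Real powers rather than \<open>sqrt\<close>: their derivative involves the exponent
  \<open>a - 1\<close>, so the induction closes when it runs over all exponents at once.\<close>

lemma smooth_upto_powr:
  assumes "0 < \<epsilon>" "\<And>t x. t \<in> I \<Longrightarrow> \<epsilon> \<le> f t x"
  shows "smooth_upto I n f \<Longrightarrow> smooth_upto I n (\<lambda>t x. f t x powr a)"
proof (induction n arbitrary: a)
  case 0
  then show ?case
    using bounded_continuous_powr[OF _ assms] by simp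
next
  case (Suc n)
  obtain ft fx where f:
    "\<And>t x. t \<in> I \<Longrightarrow> ((\<lambda>s. f s x) has_real_derivative ft t x) (at t within I)"
    "\<And>t x. t \<in> I \<Longrightarrow> (f t has_real_derivative fx t x) (at x)"
    "smooth_upto I n ft" "smooth_upto I n fx"
    using Suc.prems(1) by (rule smooth_upto_SucE) blast
  have pos: "0 < f t x" if "t \<in> I" for t x
    using assms(1) assms(2)[OF that, of x] by simp
  have "smooth_upto I n (\<lambda>t x. f t x powr (a - 1))"
    by (rule Suc.IH[OF smooth_upto_Suc_imp[OF Suc.prems]])
  then have s: "smooth_upto I n (\<lambda>t x. (a * f t x powr (a - 1)) * g t x)" if "smooth_upto I n g" for g
    using that by (intro smooth_upto_mult smooth_upto_const)
  show ?case
  proof (rule smooth_upto_SucI)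
    show "((\<lambda>s. f s x powr a) has_real_derivative (a * f t x powr (a - 1)) * ft t x) (at t within I)"
      if "t \<in> I" for t x
      by (rule DERIV_chain2[OF has_real_derivative_powr[OF pos[OF that]] f(1)[OF that]])
    show "((\<lambda>y. f t y powr a) has_real_derivative (a * f t x powr (a - 1)) * fx t x) (at x)"
      if "t \<in> I" for t x
      by (rule DERIV_chain2[OF has_real_derivative_powr[OF pos[OF that]] f(2)[OF that]])
    show "bounded_continuous I (\<lambda>t x. f t x powr a)"
      by (rule bounded_continuous_powr[OF smooth_upto_imp_bounded_continuous[OF Suc.prems] assms])
  qed (rule s, rule f)+
qed

lemma smooth_upto_cong:
  assumes "smooth_upto I n f" "\<And>t x. t \<in> I \<Longrightarrow> f t x = g t x"
  shows "smooth_upto I n g"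
proof -
  have bc: "bounded_continuous I g"
  proof -
    have "continuous_on (I \<times> UNIV) (\<lambda>(t, x). f t x) = continuous_on (I \<times> UNIV) (\<lambda>(t, x). g t x)"
      by (rule continuous_on_cong) (use assms(2) in auto)
    then show ?thesis
      using smooth_upto_imp_bounded_continuous[OF assms(1)] assms(2) by (auto simp: bounded_continuous_iff)
  qed
  show ?thesis
  proof (cases n)
    case (Suc m)
    obtain ft fx where f:
      "\<And>t x. t \<in> I \<Longrightarrow> ((\<lambda>s. f s x) has_real_derivative ft t x) (at t within I)"
      "\<And>t x. t \<in> I \<Longrightarrow> (f t has_real_derivative fx t x) (at x)"
      "smooth_upto I m ft" "smooth_upto I m fx"
      using assms(1) unfolding Suc by (rule smooth_upto_SucE) blast
    have "f t = g t" if "t \<in> I" for t using assms(2)[OF that] by auto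
    with f(2) have x: "(g t has_real_derivative fx t x) (at x)" if "t \<in> I" for t x
      using that by metis
    have t: "((\<lambda>s. g s x) has_real_derivative ft t x) (at t within I)" if "t \<in> I" for t x
      by (rule has_field_derivative_transform_within[OF f(1)[OF that] zero_less_one that])
        (use assms(2) in auto)
    show ?thesis unfolding Suc
      by (rule smooth_upto_SucI[OF bc t x f(3,4)])
  qed (simp add: bc)
qed

lemma smooth_upto_sqrt:
  assumes "0 < \<epsilon>" "\<And>t x. t \<in> I \<Longrightarrow> \<epsilon> \<le> f t x" "smooth_upto I n f"
  shows "smooth_upto I n (\<lambda>t x. sqrt (f t x))"
proof (rule smooth_upto_cong)
  show "smooth_upto I n (\<lambda>t x. f t x powr (1/2))"
    using assms by (rule smooth_upto_powr)
  show "f t x powr (1/2) = sqrt (f t x)" if "t \<in> I" for t x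
    using assms(1) assms(2)[OF that, of x] by (simp add: powr_half_sqrt)
qed

lemma smooth_upto_subset:
  assumes "J \<subseteq> I"
  shows "smooth_upto I n f \<Longrightarrow> smooth_upto J n f"
proof (induction n arbitrary: f)
  case 0
  then show ?case
    using assms unfolding smooth_upto.simps bounded_continuous_iff
    by (auto intro: continuous_on_subset[of "I \<times> UNIV" _ "J \<times> UNIV"])
next
  case (Suc n)
  obtain ft fx where f:
    "\<And>t x. t \<in> I \<Longrightarrow> ((\<lambda>s. f s x) has_real_derivative ft t x) (at t within I)"
    "\<And>t x. t \<in> I \<Longrightarrow> (f t has_real_derivative fx t x) (at x)"
    "smooth_upto I n ft" "smooth_upto I n fx"
    using Suc.prems by (rule smooth_upto_SucE) blast
  have "bounded_continuous J f"
    using smooth_upto_imp_bounded_continuous[OF Suc.prems] assms unfolding bounded_continuous_iff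
    by (auto intro: continuous_on_subset[of "I \<times> UNIV" _ "J \<times> UNIV"])
  moreover have "((\<lambda>s. f s x) has_real_derivative ft t x) (at t within J)" if "t \<in> J" for t x
    by (rule DERIV_subset[OF f(1) assms]) (use that assms in blast)
  moreover have "(f t has_real_derivative fx t x) (at x)" if "t \<in> J" for t x
    by (rule f(2)) (use that assms in blast)
  ultimately show ?case
    by (rule smooth_upto_SucI[OF _ _ _ Suc.IH[OF f(3)] Suc.IH[OF f(4)]])
qed

text \<open>A quantitative companion of \<open>smooth_upto\<close>: one bound for all derivatives of
  total order at most \<open>n\<close>, which may depend on time. This dependence carries the decay
  that makes the residuals summable.\<close>

primrec derivs_le :: "real set \<Rightarrow> (real \<Rightarrow> real) \<Rightarrow> nat \<Rightarrow> (real \<Rightarrow> real \<Rightarrow> real) \<Rightarrow> bool" where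
  "derivs_le I B 0 f \<longleftrightarrow> (\<forall>t\<in>I. \<forall>x. \<bar>f t x\<bar> \<le> B t)"
| "derivs_le I B (Suc n) f \<longleftrightarrow> (\<forall>t\<in>I. \<forall>x. \<bar>f t x\<bar> \<le> B t) \<and>
     (\<exists>ft fx. (\<forall>t\<in>I. \<forall>x. ((\<lambda>s. f s x) has_real_derivative ft t x) (at t within I) \<and>
                        (f t has_real_derivative fx t x) (at x)) \<and>
              derivs_le I B n ft \<and> derivs_le I B n fx)"

lemma derivs_leD: "derivs_le I B n f \<Longrightarrow> t \<in> I \<Longrightarrow> \<bar>f t x\<bar> \<le> B t"
  by (cases n) auto

lemma derivs_le_SucE:
  assumes "derivs_le I B (Suc n) f"
  obtains ft fx where
    "\<And>t x. t \<in> I \<Longrightarrow> ((\<lambda>s. f s x) has_real_derivative ft t x) (at t within I)"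
    "\<And>t x. t \<in> I \<Longrightarrow> (f t has_real_derivative fx t x) (at x)"
    "derivs_le I B n ft" "derivs_le I B n fx"
  using assms unfolding derivs_le.simps by blast

lemma derivs_le_SucI:
  assumes "\<And>t x. t \<in> I \<Longrightarrow> \<bar>f t x\<bar> \<le> B t"
    "\<And>t x. t \<in> I \<Longrightarrow> ((\<lambda>s. f s x) has_real_derivative ft t x) (at t within I)"
    "\<And>t x. t \<in> I \<Longrightarrow> (f t has_real_derivative fx t x) (at x)"
    "derivs_le I B n ft" "derivs_le I B n fx"
  shows "derivs_le I B (Suc n) f"
  using assms unfolding derivs_le.simps by blast

lemma derivs_le_mono:
  assumes le: "\<And>t. t \<in> I \<Longrightarrow> B t \<le> B' t"
  shows "derivs_le I B n f \<Longrightarrow> derivs_le I B' n f"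
proof (induction n arbitrary: f)
  case 0
  then show ?case unfolding derivs_le.simps using le by (meson order_trans)
next
  case (Suc n)
  obtain ft fx where f:
    "\<And>t x. t \<in> I \<Longrightarrow> ((\<lambda>s. f s x) has_real_derivative ft t x) (at t within I)"
    "\<And>t x. t \<in> I \<Longrightarrow> (f t has_real_derivative fx t x) (at x)"
    "derivs_le I B n ft" "derivs_le I B n fx"
    using Suc.prems by (rule derivs_le_SucE) blast
  have "\<bar>f t x\<bar> \<le> B' t" if "t \<in> I" for t x
    using derivs_leD[OF Suc.prems that, of x] le[OF that] by simp
  then show ?case
    by (rule derivs_le_SucI[OF _ f(1,2) Suc.IH[OF f(3)] Suc.IH[OF f(4)]])
qed

lemma smooth_upto_imp_derivs_le_const:
  "smooth_upto I n f \<Longrightarrow> \<exists>C\<ge>0. derivs_le I (\<lambda>_. C) n f"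
proof (induction n arbitrary: f)
  case 0
  then obtain K where "\<forall>t\<in>I. \<forall>x. \<bar>f t x\<bar> \<le> K"
    by (auto simp: bounded_continuous_iff)
  then show ?case
    by (intro exI[of _ "max K 0"]) (auto simp: le_max_iff_disj)
next
  case (Suc n)
  obtain ft fx where f:
    "\<And>t x. t \<in> I \<Longrightarrow> ((\<lambda>s. f s x) has_real_derivative ft t x) (at t within I)"
    "\<And>t x. t \<in> I \<Longrightarrow> (f t has_real_derivative fx t x) (at x)"
    "smooth_upto I n ft" "smooth_upto I n fx"
    using Suc.prems by (rule smooth_upto_SucE) blast
  obtain K where K: "\<And>t x. t \<in> I \<Longrightarrow> \<bar>f t x\<bar> \<le> K"
    using smooth_upto_imp_bounded_continuous[OF Suc.prems] unfolding bounded_continuous_iff by blast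
  obtain C1 where C1: "C1 \<ge> 0" "derivs_le I (\<lambda>_. C1) n ft"
    using Suc.IH[OF f(3)] by blast
  obtain C2 where C2: "C2 \<ge> 0" "derivs_le I (\<lambda>_. C2) n fx"
    using Suc.IH[OF f(4)] by blast
  let ?C = "max K (max C1 C2)"
  have "derivs_le I (\<lambda>_. ?C) (Suc n) f"
  proof (rule derivs_le_SucI[OF _ f(1,2)])
    show "\<bar>f t x\<bar> \<le> ?C" if "t \<in> I" for t x using K[OF that, of x] by simp
    show "derivs_le I (\<lambda>_. ?C) n ft" by (rule derivs_le_mono[OF _ C1(2)]) simp
    show "derivs_le I (\<lambda>_. ?C) n fx" by (rule derivs_le_mono[OF _ C2(2)]) simp
  qed
  then show ?case
    using C1(1) by (intro exI[of _ ?C] conjI) auto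
qed

text \<open>The nested existential quantifiers are unrolled along the pure spatial derivatives, so
  that these become available by index. The time derivative of the \<open>j\<close>-th one has order
  \<open>j + 1\<close>, hence \<open>j < n\<close> there.\<close>

lemma derivs_le_family:
  "derivs_le I B n f \<Longrightarrow> \<exists>g gt. g 0 = f \<and>
     (\<forall>j<n. \<forall>t\<in>I. \<forall>x. ((\<lambda>s. g j s x) has_real_derivative gt j t x) (at t within I) \<and>
        (g j t has_real_derivative g (Suc j) t x) (at x) \<and> \<bar>gt j t x\<bar> \<le> B t) \<and>
     (\<forall>j\<le>n. \<forall>t\<in>I. \<forall>x. \<bar>g j t x\<bar> \<le> B t)"
proof (induction n arbitrary: f)
  case 0
  then show ?case by (intro exI[of _ "\<lambda>_. f"]) simp
next
  case (Suc n)
  obtain ft fx where f: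
    "\<And>t x. t \<in> I \<Longrightarrow> ((\<lambda>s. f s x) has_real_derivative ft t x) (at t within I)"
    "\<And>t x. t \<in> I \<Longrightarrow> (f t has_real_derivative fx t x) (at x)"
    "derivs_le I B n ft" "derivs_le I B n fx"
    using Suc.prems by (rule derivs_le_SucE) blast
  obtain g gt where g: "g 0 = fx"
     "\<forall>j<n. \<forall>t\<in>I. \<forall>x. ((\<lambda>s. g j s x) has_real_derivative gt j t x) (at t within I) \<and>
        (g j t has_real_derivative g (Suc j) t x) (at x) \<and> \<bar>gt j t x\<bar> \<le> B t"
     "\<forall>j\<le>n. \<forall>t\<in>I. \<forall>x. \<bar>g j t x\<bar> \<le> B t"
    using Suc.IH[OF f(4)] by (elim exE conjE) (rule that)
  let ?g = "case_nat f g" and ?gt = "case_nat ft gt"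
  have 1: "((\<lambda>s. ?g j s x) has_real_derivative ?gt j t x) (at t within I) \<and>
      (?g j t has_real_derivative ?g (Suc j) t x) (at x) \<and> \<bar>?gt j t x\<bar> \<le> B t"
    if "j < Suc n" "t \<in> I" for j t x
  proof (cases j)
    case 0
    then show ?thesis
      using f(1,2)[OF that(2), of x] derivs_leD[OF f(3) that(2), of x] by (simp add: g(1))
  next
    case (Suc i)
    then show ?thesis
      using g(2)[rule_format, of i t x] that by (simp only: nat.case Suc_less_eq)
  qed
  have 2: "\<bar>?g j t x\<bar> \<le> B t" if "j \<le> Suc n" "t \<in> I" for j t x
    using derivs_leD[OF Suc.prems that(2), of x] g(3)[rule_format, of "j - 1" t x] that by (cases j) simp_all
  have 3: "?g 0 = f" by simp
  show ?case
    by (rule exI[of _ ?g], rule exI[of _ ?gt]) (intro conjI allI ballI impI 3; use 1 2 in blast)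
qed

text \<open>Landau's inequality: if \<open>f\<close> is of size \<open>e\<close> and \<open>f''\<close> is bounded, then \<open>f'\<close> is of size
  \<open>sqrt e\<close>, so each derivative decays at half the rate of the previous one.\<close>

lemma decay_derivative:
  fixes f :: "real \<Rightarrow> real"
  assumes f: "\<And>s. s \<in> S \<Longrightarrow> (f has_real_derivative f' s) (at s within S)"
    and f': "\<And>s. s \<in> S \<Longrightarrow> (f' has_real_derivative f'' s) (at s within S)"
    and K: "\<And>s. s \<in> S \<Longrightarrow> \<bar>f'' s\<bar> \<le> K"
    and S: "convex S" "a \<in> S" "a + s \<in> S" "0 < s"
    and e: "\<bar>f a\<bar> \<le> C * s\<^sup>2" "\<bar>f (a + s)\<bar> \<le> C * s\<^sup>2"
  shows "\<bar>f' a\<bar> \<le> (2 * C + K) * s"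
proof -
  have "\<bar>f (a + s) - f a - (a + s - a) * f' a\<bar> \<le> K * (a + s - a)\<^sup>2"
    by (rule taylor1_bound[OF S(1-3) _ f f' K]) (use S(4) in simp_all)
  then have "\<bar>f (a + s) - f a - s * f' a\<bar> \<le> K * s\<^sup>2" by simp
  then have "\<bar>s * f' a\<bar> \<le> (2 * C + K) * s\<^sup>2"
    using e unfolding distrib_right by linarith
  then have "s * \<bar>f' a\<bar> \<le> s * ((2 * C + K) * s)"
    using \<open>0 < s\<close> by (simp add: abs_mult power2_eq_square mult_ac)
  then show ?thesis using \<open>0 < s\<close> by simp
qed

text \<open>Landau's inequality is applied to the time and to the space derivative, and the
  induction hypothesis to both with half the rate. One order is lost because the derivatives of top
  order have no bounded second antecedent: a derivative decays only if the next one is bounded. In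
  time the step goes forward, so that \<open>t = 0\<close> is covered.\<close>

lemma smooth_upto_decay:
  assumes "smooth_upto {0..} (Suc n) f" "0 < \<mu>"
    "\<And>t x. 0 \<le> t \<Longrightarrow> \<bar>f t x\<bar> \<le> C * exp (- \<mu> * t)"
  shows "\<exists>C' \<mu>'. 0 \<le> C' \<and> 0 < \<mu>' \<and> derivs_le {0..} (\<lambda>t. C' * exp (- \<mu>' * t)) n f"
  using assms
proof (induction n arbitrary: f C \<mu>)
  case 0
  have "0 \<le> C" using 0(3)[of 0] by (auto intro: order_trans[OF abs_ge_zero])
  with 0 show ?case by auto
next
  case (Suc n)
  have "0 \<le> C" using Suc.prems(3)[of 0] by (auto intro: order_trans[OF abs_ge_zero])
  obtain ft fx where f:
    "\<And>t x. t \<in> {0..} \<Longrightarrow> ((\<lambda>s. f s x) has_real_derivative ft t x) (at t within {0..})"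
    "\<And>t x. t \<in> {0..} \<Longrightarrow> (f t has_real_derivative fx t x) (at x)"
    "smooth_upto {0..} (Suc n) ft" "smooth_upto {0..} (Suc n) fx"
    using Suc.prems(1) by (rule smooth_upto_SucE) blast
  obtain ftt ftx where ft:
    "\<And>t x. t \<in> {0..} \<Longrightarrow> ((\<lambda>s. ft s x) has_real_derivative ftt t x) (at t within {0..})"
    "smooth_upto {0..} n ftt"
    using f(3) by (rule smooth_upto_SucE) blast
  obtain fxt fxx where fx:
    "\<And>t x. t \<in> {0..} \<Longrightarrow> (fx t has_real_derivative fxx t x) (at x)"
    "smooth_upto {0..} n fxx"
    using f(4) by (rule smooth_upto_SucE) blast
  obtain K L where K: "\<And>t x. t \<in> {0..} \<Longrightarrow> \<bar>ftt t x\<bar> \<le> K" and L: "\<And>t x. t \<in> {0..} \<Longrightarrow> \<bar>fxx t x\<bar> \<le> L"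
    using smooth_upto_imp_bounded_continuous[OF ft(2)] smooth_upto_imp_bounded_continuous[OF fx(2)]
    unfolding bounded_continuous_iff by blast
  \<comment> \<open>The step width that balances the two parts of the estimate: size of
    \<open>f\<close> over \<open>s\<close>, and \<open>s\<close> times the second
    derivative.\<close>
  define s where "s = (\<lambda>t. exp (- (\<mu> / 2) * t))"
  have s: "0 < s t" "(s t)\<^sup>2 = exp (- \<mu> * t)" for t
    by (auto simp: s_def power2_eq_square simp flip: exp_add)
  have ft_le: "\<bar>ft t x\<bar> \<le> (2 * C + K) * s t" if t: "0 \<le> t" for t x
  proof (rule decay_derivative[where S = "{0..}" and f = "\<lambda>r. f r x" and f' = "\<lambda>r. ft r x" and f'' = "\<lambda>r. ftt r x"])
    show "\<bar>f (t + s t) x\<bar> \<le> C * (s t)\<^sup>2"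
    proof -
      have "\<bar>f (t + s t) x\<bar> \<le> C * exp (- \<mu> * (t + s t))"
        using t s(1)[of t] by (intro Suc.prems(3)) simp
      also have "\<dots> \<le> C * exp (- \<mu> * t)"
        using \<open>0 \<le> C\<close> s(1)[of t] \<open>0 < \<mu>\<close> by (intro mult_left_mono) auto
      finally show ?thesis by (simp add: s)
    qed
  qed (use t f(1) ft(1) K s Suc.prems(3)[OF t] in \<open>simp_all add: add_nonneg_nonneg less_imp_le\<close>)
  have fx_le: "\<bar>fx t x\<bar> \<le> (2 * C + L) * s t" if t: "0 \<le> t" for t x
    by (rule decay_derivative[where S = UNIV and f = "f t" and f' = "fx t" and f'' = "fxx t" and a = x])
      (use t f(2) fx(1) L s Suc.prems(3)[OF t] in simp_all)
  obtain C1 \<mu>1 where 1: "0 \<le> C1" "0 < \<mu>1" "derivs_le {0..} (\<lambda>t. C1 * exp (- \<mu>1 * t)) n ft"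
    using Suc.IH[OF f(3), of "\<mu> / 2" "2 * C + K"] ft_le \<open>0 < \<mu>\<close> by (auto simp: s_def)
  obtain C2 \<mu>2 where 2: "0 \<le> C2" "0 < \<mu>2" "derivs_le {0..} (\<lambda>t. C2 * exp (- \<mu>2 * t)) n fx"
    using Suc.IH[OF f(4), of "\<mu> / 2" "2 * C + L"] fx_le \<open>0 < \<mu>\<close> by (auto simp: s_def)
  define C' \<mu>' where "C' = C + C1 + C2" and "\<mu>' = min \<mu> (min \<mu>1 \<mu>2)"
  have le: "D * exp (- \<nu> * t) \<le> C' * exp (- \<mu>' * t)"
    if "0 \<le> D" "D \<le> C'" "\<mu>' \<le> \<nu>" "0 \<le> t" for D \<nu> t
    using that by (intro mult_mono) (auto simp: mult_right_mono)
  have ft: "derivs_le {0..} (\<lambda>t. C' * exp (- \<mu>' * t)) n ft"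
    by (rule derivs_le_mono[OF _ 1(3)]) (rule le, use \<open>0 \<le> C\<close> 1 2 in \<open>auto simp: C'_def \<mu>'_def\<close>)
  have fx: "derivs_le {0..} (\<lambda>t. C' * exp (- \<mu>' * t)) n fx"
    by (rule derivs_le_mono[OF _ 2(3)]) (rule le, use \<open>0 \<le> C\<close> 1 2 in \<open>auto simp: C'_def \<mu>'_def\<close>)
  have "\<bar>f t x\<bar> \<le> C' * exp (- \<mu>' * t)" if "t \<in> {0..}" for t x
    using Suc.prems(3)[of t x] le[of C \<mu> t] that \<open>0 \<le> C\<close> 1(1) 2(1)
    by (auto simp: C'_def \<mu>'_def)
  then have "derivs_le {0..} (\<lambda>t. C' * exp (- \<mu>' * t)) (Suc n) f"
    by (rule derivs_le_SucI[OF _ f(1,2) ft fx])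
  moreover have "0 \<le> C'" "0 < \<mu>'"
    using \<open>0 \<le> C\<close> \<open>0 < \<mu>\<close> 1 2 by (auto simp: C'_def \<mu>'_def)
  ultimately show ?case by blast
qed

section \<open>Truncation error\<close>

lemma periodic_frac:
  fixes f :: "real \<Rightarrow> 'a"
  assumes "\<And>x. f (x + 1) = f x"
  shows "f x = f (frac x)"
proof -
  interpret periodic_fun_simple' f
    by unfold_locales (fact assms)
  show ?thesis
    unfolding frac_def by (rule minus_of_int[symmetric])
qed

lemma periodic_derivative:
  fixes f :: "real \<Rightarrow> real"
  assumes per: "\<And>x. f (x + 1) = f x" and d: "\<And>x. (f has_real_derivative f' x) (at x)"
  shows "f' (x + 1) = f' x"
proof -
  have "((\<lambda>y. f (y + 1)) has_real_derivative f' (x + 1)) (at x)"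
    using DERIV_shift[of f "f' (x + 1)" x 1] d by simp
  then show ?thesis
    using DERIV_unique[OF _ d] per by simp
qed

lemma mesh_pos: "0 < N \<Longrightarrow> 0 < mesh N"
  by (simp add: mesh_def)

lemma periodic_nxt:
  fixes f :: "real \<Rightarrow> real"
  assumes "\<And>x. f (x + 1) = f x" "i < N"
  shows "f (real (nxt N i) * mesh N) = f (real i * mesh N + mesh N)"
proof (cases "Suc i = N")
  case True
  have "real i * mesh N + mesh N = real (Suc i) * mesh N" by (simp add: algebra_simps)
  also have "\<dots> = 0 + 1" unfolding True using assms(2) by (simp add: mesh_def)
  finally show ?thesis
    using True assms(1)[of 0] by (simp add: nxt_def)
next
  case False
  with assms(2) show ?thesis by (simp add: nxt_def algebra_simps)
qed

lemma periodic_prv: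
  fixes f :: "real \<Rightarrow> real"
  assumes per: "\<And>x. f (x + 1) = f x" and "i < N"
  shows "f (real (prv N i) * mesh N) = f (real i * mesh N - mesh N)"
proof -
  have "f (x + 1 - mesh N) = f (x - mesh N)" for x
    using per[of "x - mesh N"] by (simp add: algebra_simps)
  then show ?thesis
    using periodic_nxt[of "\<lambda>x. f (x - mesh N)" "prv N i" N] per assms(2)
    by (simp add: nxt_prv diff_add_eq)
qed

lemma dsecond_grid:
  assumes "\<And>x. f (x + 1) = f x" "i < N"
  shows "dsecond N (\<lambda>j. f (real j * mesh N)) i = cdiff2 (mesh N) f (real i * mesh N)"
  using assms by (simp add: dsecond_eq cdiff2_def periodic_nxt periodic_prv)

lemma dcentral_grid:
  assumes "\<And>x. f (x + 1) = f x" "i < N"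
  shows "dcentral N (\<lambda>j. f (real j * mesh N)) i = cdiff (mesh N) f (real i * mesh N)"
  using assms by (simp add: dcentral_def cdiff_def periodic_nxt periodic_prv)

lemma dsecond_cong:
  "(\<And>j. j < N \<Longrightarrow> f j = g j) \<Longrightarrow> i < N \<Longrightarrow> dsecond N f i = dsecond N g i"
  by (simp add: dsecond_eq)

lemma periodic_cdiff2:
  fixes f :: "real \<Rightarrow> real"
  assumes "\<And>x. f (x + 1) = f x"
  shows "cdiff2 h f (x + 1) = cdiff2 h f x"
  using assms[of "x + h"] assms[of "x - h"] assms[of x] by (simp add: cdiff2_def algebra_simps)

lemma dvd_rhs_grid:
  assumes per: "\<And>x. f (x + 1) = f x" and nz: "\<And>x. f x \<noteq> 0" and i: "i < N"
  shows "dvd_rhs \<delta> N (\<lambda>j. f (real j * mesh N)) i =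
    (let h = mesh N; x = real i * h in
      - 1/2 * cdiff2 h (cdiff2 h f) x + (cdiff2 h f x)\<^sup>2 / (2 * f x) + \<delta> / 2 * cdiff h (cdiff2 h f) x)"
proof -
  let ?h = "mesh N" and ?f = "\<lambda>j. f (real j * mesh N)"
  have eq: "dsecond N ?f j = (\<lambda>j. cdiff2 ?h f (real j * ?h)) j" if "j < N" for j
    by (simp add: dsecond_grid per that)
  have "dsecond N (dsecond N ?f) i = dsecond N (\<lambda>j. cdiff2 ?h f (real j * ?h)) i"
    by (rule dsecond_cong[OF eq i])
  moreover have "dcentral N (dsecond N ?f) i = dcentral N (\<lambda>j. cdiff2 ?h f (real j * ?h)) i"
    by (rule dcentral_cong[OF eq i])
  ultimately show ?thesis
    using dvd_rhs_eq[of N ?f i \<delta>] nz i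
    by (simp add: dsecond_grid dcentral_grid periodic_cdiff2 per Let_def)
qed

lemma DERIV_mean:
  fixes f g :: "real \<Rightarrow> real"
  assumes "(f has_real_derivative f') (at x)" "(g has_real_derivative g') (at x)"
  shows "((\<lambda>x. (g x + f x) / 2) has_real_derivative (g' + f') / 2) (at x)"
  by (intro DERIV_cdivide DERIV_add assms)

lemma abs_diff_triangle: "\<bar>a - b\<bar> \<le> r \<Longrightarrow> \<bar>b - c\<bar> \<le> s \<Longrightarrow> \<bar>a - c\<bar> \<le> r + (s::real)"
  by linarith

lemma abs_combination_le:
  fixes a b c d :: real
  assumes "\<bar>a\<bar> \<le> A" "\<bar>b\<bar> \<le> B" "\<bar>c\<bar> \<le> C" "\<bar>d\<bar> \<le> D"
  shows "\<bar>a + 1/2 * b - 1/2 * c - d\<bar> \<le> A + 1/2 * B + 1/2 * C + D"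
  using assms by linarith

text \<open>The bound is kept linear in \<open>B\<close>, since \<open>B\<close> will be the
  decaying bound at the current time and \<open>C\<close> its value at time 0. Of several small
  factors one supplies \<open>B\<close> and the others are estimated by \<open>C\<close>;
  \<open>6 = 2 * 3\<close> comes from the bounds on \<open>p - q\<close> and on
  \<open>p + q\<close>.\<close>

lemma quotient_error:
  fixes p q w v :: real
  assumes "0 < \<epsilon>" "\<epsilon> \<le> w" "\<epsilon> \<le> v" and p: "\<bar>p\<bar> \<le> 2 * B" and q: "\<bar>q\<bar> \<le> B" and "B \<le> C"
    and pq: "\<bar>p - q\<bar> \<le> 2 * B * s" and wv: "\<bar>v - w\<bar> \<le> B * s"
  shows "\<bar>p\<^sup>2 / w - q\<^sup>2 / v\<bar> \<le> (6 * C / \<epsilon> + C\<^sup>2 / \<epsilon>\<^sup>2) * B * s"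
proof -
  have B: "0 \<le> B" using q by linarith
  have C: "0 \<le> C" using B assms by linarith
  have Bs: "0 \<le> B * s" using wv by linarith
  have pos: "0 < w" "0 < v" using assms by auto
  have e: "p\<^sup>2 / w - q\<^sup>2 / v = (p - q) * (p + q) / w + q\<^sup>2 * (v - w) / (w * v)"
    using pos by (simp add: field_simps power2_eq_square)
  have "\<bar>(p - q) * (p + q)\<bar> \<le> (2 * B * s) * (3 * C)"
    unfolding abs_mult using p q pq Bs \<open>B \<le> C\<close> by (intro mult_mono) auto
  then have "\<bar>(p - q) * (p + q) / w\<bar> \<le> (2 * B * s) * (3 * C) / \<epsilon>"
    unfolding abs_divide using assms pos Bs C by (intro frac_le) (auto simp: mult_nonneg_nonneg)
  moreover have "q\<^sup>2 \<le> C\<^sup>2"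
    using q \<open>B \<le> C\<close> C abs_le_square_iff[of q C] by simp
  then have "\<bar>q\<^sup>2 * (v - w)\<bar> \<le> C\<^sup>2 * (B * s)"
    unfolding abs_mult using wv by (intro mult_mono) auto
  then have "\<bar>q\<^sup>2 * (v - w) / (w * v)\<bar> \<le> C\<^sup>2 * (B * s) / \<epsilon>\<^sup>2"
    unfolding abs_divide using assms pos Bs
    by (intro frac_le) (auto simp: power2_eq_square abs_mult intro!: mult_mono)
  ultimately have "\<bar>p\<^sup>2 / w - q\<^sup>2 / v\<bar> \<le> (2 * B * s) * (3 * C) / \<epsilon> + C\<^sup>2 * (B * s) / \<epsilon>\<^sup>2"
    unfolding e by (intro order_trans[OF abs_triangle_ineq] add_mono)
  then show ?thesis by (simp add: algebra_simps)
qed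

text \<open>\<open>g\<close> and \<open>g'\<close> list the spatial derivatives of
  \<open>sqrt u\<close> at the two time levels. \<open>B\<close> bounds them only from order 1 on,
  because \<open>sqrt u\<close> itself tends to a positive constant. The equation is compared at the
  old time level, so moving the midpoint there costs \<open>O(\<tau>)\<close>.\<close>

lemma dvd_residual_bound:
  fixes g g' :: "nat \<Rightarrow> real \<Rightarrow> real"
  assumes per: "\<And>x. g 0 (x + 1) = g 0 x" "\<And>x. g' 0 (x + 1) = g' 0 x"
    and d: "\<And>j x. j < 6 \<Longrightarrow> (g j has_real_derivative g (Suc j) x) (at x)"
      "\<And>j x. j < 6 \<Longrightarrow> (g' j has_real_derivative g' (Suc j) x) (at x)"
    and B: "\<And>j x. 1 \<le> j \<Longrightarrow> j \<le> 6 \<Longrightarrow> \<bar>g j x\<bar> \<le> B" "\<And>j x. 1 \<le> j \<Longrightarrow> j \<le> 6 \<Longrightarrow> \<bar>g' j x\<bar> \<le> B"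
    and T: "\<And>j x. j \<le> 4 \<Longrightarrow> \<bar>g' j x - g j x\<bar> \<le> B * \<tau>"
    and lo: "0 < \<epsilon>" "\<And>x. \<epsilon> \<le> g 0 x" "\<And>x. \<epsilon> \<le> g' 0 x" and C: "B \<le> C"
    and t: "\<And>x. \<bar>(g' 0 x - g 0 x) / \<tau> - (- 1/2 * g 4 x + (g 2 x)\<^sup>2 / (2 * g 0 x) + \<delta> / 2 * g 3 x)\<bar> \<le> B * \<tau>"
    and i: "i < N" and \<tau>: "0 < \<tau>"
  shows "\<bar>dvd_residual \<delta> N \<tau> (\<lambda>j. g 0 (real j * mesh N)) (\<lambda>j. g' 0 (real j * mesh N)) i\<bar>
    \<le> (5 + 6 * C / \<epsilon> + C\<^sup>2 / \<epsilon>\<^sup>2 + 5 * \<bar>\<delta>\<bar>) * B * (\<tau> + (mesh N)\<^sup>2)"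
proof -
  define h where "h = mesh N"
  define s where "s = \<tau> + h\<^sup>2"
  have h: "0 < h" using i by (auto simp: h_def intro: mesh_pos)
  have B0: "0 \<le> B" using B(1)[of 1 0] by simp
  have Bt: "B * \<tau> \<le> B * s" and Bh: "B * h\<^sup>2 \<le> B * s" and Bs: "0 \<le> B * s"
    using B0 \<tau> by (auto simp: s_def intro: mult_left_mono)
  define w where "w = (\<lambda>j x. (g' j x + g j x) / 2)"
  define x where "x = real i * h"
  have dw: "(w j has_real_derivative w (Suc j) x) (at x)" if "j < 6" for j x
    unfolding w_def by (rule DERIV_mean[OF d(1)[OF that] d(2)[OF that]])
  have dw': "\<And>x. (w 0 has_real_derivative w 1 x) (at x)" "\<And>x. (w 1 has_real_derivative w 2 x) (at x)"
    "\<And>x. (w 2 has_real_derivative w 3 x) (at x)" "\<And>x. (w 3 has_real_derivative w 4 x) (at x)"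
    "\<And>x. (w 4 has_real_derivative w 5 x) (at x)" "\<And>x. (w 5 has_real_derivative w 6 x) (at x)"
    using dw[of 0] dw[of 1] dw[of 2] dw[of 3] dw[of 4] dw[of 5] by (simp_all add: eval_nat_numeral)
  have Bw: "\<bar>w j y\<bar> \<le> B" if "1 \<le> j" "j \<le> 6" for j y
    using B(1)[OF that, of y] B(2)[OF that, of y] by (simp add: w_def)
  have Tw: "\<bar>w j y - g j y\<bar> \<le> B * s" if "j \<le> 4" for j y
    using T[OF that, of y] Bt Bs by (simp add: w_def field_simps abs_if split: if_splits)
  have wlo: "\<epsilon> \<le> w 0 y" for y
    using lo(2)[of y] lo(3)[of y] by (simp add: w_def)
  have S2: "\<bar>cdiff2 h (w 0) x - w 2 x\<bar> \<le> 2 * B * h\<^sup>2"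
    by (rule cdiff2_error[OF dw'(1-4) Bw h]) auto
  have S2': "\<bar>cdiff2 h (w 0) x\<bar> \<le> 2 * B"
    by (rule cdiff2_bound[OF dw'(1,2) Bw h]) auto
  have dS: "\<And>x. (cdiff2 h (w 0) has_real_derivative cdiff2 h (w 1) x) (at x)"
    "\<And>x. (cdiff2 h (w 1) has_real_derivative cdiff2 h (w 2) x) (at x)"
    "\<And>x. (cdiff2 h (w 2) has_real_derivative cdiff2 h (w 3) x) (at x)"
    "\<And>x. (cdiff2 h (w 3) has_real_derivative cdiff2 h (w 4) x) (at x)"
    by (rule cdiff2_has_derivative, rule dw')+
  \<comment> \<open>The outer difference is replaced first: its error involves the fourth derivative
    of \<open>cdiff2 h (w 0)\<close>, which is \<open>cdiff2 h (w 4)\<close> and is controlled by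
    \<open>w 6\<close>. This is where six spatial derivatives are used.\<close>
  have S4: "\<bar>cdiff2 h (cdiff2 h (w 0)) x - w 4 x\<bar> \<le> 2 * (2 * B) * h\<^sup>2 + 2 * B * h\<^sup>2"
  proof (rule abs_diff_triangle)
    have "\<bar>cdiff2 h (w 4) y\<bar> \<le> 2 * B" for y
      by (rule cdiff2_bound[OF dw'(5,6) Bw h]) auto
    then show "\<bar>cdiff2 h (cdiff2 h (w 0)) x - cdiff2 h (w 2) x\<bar> \<le> 2 * (2 * B) * h\<^sup>2"
      by (rule cdiff2_error[OF dS _ h])
    show "\<bar>cdiff2 h (w 2) x - w 4 x\<bar> \<le> 2 * B * h\<^sup>2"
      by (rule cdiff2_error[OF dw'(3-6) Bw h]) auto
  qed
  have S3: "\<bar>cdiff h (cdiff2 h (w 0)) x - w 3 x\<bar> \<le> (2 * B) * h\<^sup>2 + 2 * B * h\<^sup>2"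
  proof (rule abs_diff_triangle)
    have "\<bar>cdiff2 h (w 3) y\<bar> \<le> 2 * B" for y
      by (rule cdiff2_bound[OF dw'(4,5) Bw h]) auto
    then show "\<bar>cdiff h (cdiff2 h (w 0)) x - cdiff2 h (w 1) x\<bar> \<le> (2 * B) * h\<^sup>2"
      by (rule cdiff_error[OF dS(1-3) _ h])
    show "\<bar>cdiff2 h (w 1) x - w 3 x\<bar> \<le> 2 * B * h\<^sup>2"
      by (rule cdiff2_error[OF dw'(2-5) Bw h]) auto
  qed
  have e4: "\<bar>cdiff2 h (cdiff2 h (w 0)) x - g 4 x\<bar> \<le> 7 * (B * s)"
    using abs_diff_triangle[OF S4 Tw[of 4 x]] Bh by simp
  have e3: "\<bar>cdiff h (cdiff2 h (w 0)) x - g 3 x\<bar> \<le> 5 * (B * s)"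
    using abs_diff_triangle[OF S3 Tw[of 3 x]] Bh by simp
  \<comment> \<open>The time part is estimated by \<open>B * \<tau>\<close> and not by the coarser
    \<open>B * s\<close> of \<open>Tw\<close>, which would give \<open>3 * B * s\<close>, more than
    \<open>quotient_error\<close> admits.\<close>
  have "\<bar>cdiff2 h (w 0) x - g 2 x\<bar> \<le> 2 * B * s"
  proof -
    have "\<bar>w 2 x - g 2 x\<bar> \<le> B * \<tau>"
      using T[of 2 x] by (simp add: w_def field_simps abs_if split: if_splits)
    then have "\<bar>cdiff2 h (w 0) x - g 2 x\<bar> \<le> 2 * B * h\<^sup>2 + B * \<tau>"
      by (rule abs_diff_triangle[OF S2])
    also have "\<dots> \<le> 2 * B * s" using B0 \<tau> by (simp add: s_def algebra_simps)
    finally show ?thesis .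
  qed
  then have e2: "\<bar>(cdiff2 h (w 0) x)\<^sup>2 / w 0 x - (g 2 x)\<^sup>2 / g 0 x\<bar>
      \<le> (6 * C / \<epsilon> + C\<^sup>2 / \<epsilon>\<^sup>2) * B * s"
    using Tw[of 0 x] by (intro quotient_error lo wlo S2' B C) (auto simp: abs_minus_commute)
  have e1: "\<bar>(g' 0 x - g 0 x) / \<tau> - (- 1/2 * g 4 x + (g 2 x)\<^sup>2 / (2 * g 0 x) + \<delta> / 2 * g 3 x)\<bar> \<le> B * s"
    using t[of x] Bt by linarith
  have mid: "midpoint (\<lambda>j. g 0 (real j * mesh N)) (\<lambda>j. g' 0 (real j * mesh N)) = (\<lambda>j. w 0 (real j * mesh N))"
    by (auto simp: midpoint_def w_def)
  have "dvd_residual \<delta> N \<tau> (\<lambda>j. g 0 (real j * mesh N)) (\<lambda>j. g' 0 (real j * mesh N)) i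
    = ((g' 0 x - g 0 x) / \<tau> - (- 1/2 * g 4 x + (g 2 x)\<^sup>2 / (2 * g 0 x) + \<delta> / 2 * g 3 x))
      + 1/2 * (cdiff2 h (cdiff2 h (w 0)) x - g 4 x)
      - 1/2 * ((cdiff2 h (w 0) x)\<^sup>2 / w 0 x - (g 2 x)\<^sup>2 / g 0 x)
      - \<delta> / 2 * (cdiff h (cdiff2 h (w 0)) x - g 3 x)"
  proof -
    have "w 0 y \<noteq> 0" for y using wlo[of y] lo(1) by auto
    moreover have "w 0 (y + 1) = w 0 y" for y by (simp add: w_def per)
    ultimately have rhs: "dvd_rhs \<delta> N (\<lambda>j. w 0 (real j * mesh N)) i
      = - 1/2 * cdiff2 h (cdiff2 h (w 0)) x + 1/2 * ((cdiff2 h (w 0) x)\<^sup>2 / w 0 x)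
        + \<delta> / 2 * cdiff h (cdiff2 h (w 0)) x"
      by (simp add: dvd_rhs_grid i Let_def h_def x_def)
    show ?thesis
      unfolding dvd_residual_def mid rhs unfolding h_def[symmetric] x_def[symmetric]
      by (simp add: algebra_simps diff_divide_distrib)
  qed
  note R = this
  have e3': "\<bar>\<delta> / 2 * (cdiff h (cdiff2 h (w 0)) x - g 3 x)\<bar> \<le> \<bar>\<delta>\<bar> / 2 * (5 * (B * s))"
    unfolding abs_mult using e3 by (auto intro!: mult_left_mono)
  have "\<bar>dvd_residual \<delta> N \<tau> (\<lambda>j. g 0 (real j * mesh N)) (\<lambda>j. g' 0 (real j * mesh N)) i\<bar>
    \<le> B * s + 1/2 * (7 * (B * s)) + 1/2 * ((6 * C / \<epsilon> + C\<^sup>2 / \<epsilon>\<^sup>2) * B * s) + \<bar>\<delta>\<bar> / 2 * (5 * (B * s))"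
    unfolding R by (rule abs_combination_le[OF e1 e4 e2 e3'])
  also have "\<dots> \<le> (5 + 6 * C / \<epsilon> + C\<^sup>2 / \<epsilon>\<^sup>2 + 5 * \<bar>\<delta>\<bar>) * B * s"
  proof -
    have *: "Y + 1/2 * (7 * Y) + 1/2 * (X * Y) + \<bar>\<delta>\<bar> / 2 * (5 * Y) \<le> (5 + X + 5 * \<bar>\<delta>\<bar>) * Y"
      if "0 \<le> X" "0 \<le> Y" for X Y
    proof -
      have "Y + 1/2 * (7 * Y) + 1/2 * (X * Y) + \<bar>\<delta>\<bar> / 2 * (5 * Y) = (9/2 + X / 2 + 5/2 * \<bar>\<delta>\<bar>) * Y"
        by (simp add: algebra_simps)
      also have "\<dots> \<le> (5 + X + 5 * \<bar>\<delta>\<bar>) * Y"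
        using that by (intro mult_right_mono) auto
      finally show ?thesis .
    qed
    show ?thesis
      using *[of "6 * C / \<epsilon> + C\<^sup>2 / \<epsilon>\<^sup>2" "B * s"] Bs B0 C lo(1) by (simp add: mult.assoc add.assoc)
  qed
  finally show ?thesis by (simp add: s_def h_def)
qed

text \<open>The continuous counterpart of \<open>dvd_rhs_eq\<close>: the flux \<open>u\<close> times
  the derivative of \<open>- v2 / v\<close> is minus the Wronskian \<open>v3 v - v2 v1\<close>,
  whose derivative has no third-order term left.\<close>

lemma pde_rhs_eq:
  assumes v: "\<And>x. 0 < v x" "\<And>x. w x = (v x)\<^sup>2"
    and d: "\<And>x. (v has_real_derivative v1 x) (at x)" "\<And>x. (v1 has_real_derivative v2 x) (at x)"
      "\<And>x. (v2 has_real_derivative v3 x) (at x)" "\<And>x. (v3 has_real_derivative v4 x) (at x)"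
  shows "1 / (2 * sqrt (w x)) * deriv (\<lambda>y. w y * deriv (fisher_deriv w) y) x
      - \<delta> / 2 * deriv (\<lambda>y. sqrt (w y) * fisher_deriv w y) x
    = - 1/2 * v4 x + (v2 x)\<^sup>2 / (2 * v x) + \<delta> / 2 * v3 x"
proof -
  have nz: "v y \<noteq> 0" for y using v(1)[of y] by simp
  have sq: "sqrt (w y) = v y" for y using v(1)[of y] by (simp add: v(2))
  have "deriv v = v1" "deriv v1 = v2" using d(1,2) by (auto intro: DERIV_imp_deriv)
  then have F: "fisher_deriv w = (\<lambda>y. - v2 y / v y)"
    by (auto simp: fisher_deriv_def sq)
  have "(fisher_deriv w has_real_derivative - (v3 y * v y - v2 y * v1 y) / (v y * v y)) (at y)" for y
    unfolding F by (rule derivative_eq_intros refl d nz)+ (simp add: algebra_simps)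
  then have "deriv (fisher_deriv w) = (\<lambda>y. - (v3 y * v y - v2 y * v1 y) / (v y * v y))"
    by (auto intro: DERIV_imp_deriv)
  then have 1: "(\<lambda>y. w y * deriv (fisher_deriv w) y) = (\<lambda>y. - (v3 y * v y - v2 y * v1 y))"
    using nz by (auto simp: v(2) power2_eq_square)
  have "((\<lambda>y. - (v3 y * v y - v2 y * v1 y)) has_real_derivative - (v4 x * v x - v2 x * v2 x)) (at x)"
    by (rule derivative_eq_intros refl d)+ (simp add: algebra_simps)
  then have 2: "deriv (\<lambda>y. w y * deriv (fisher_deriv w) y) x = - (v4 x * v x - v2 x * v2 x)"
    unfolding 1 by (rule DERIV_imp_deriv)
  have 3: "(\<lambda>y. sqrt (w y) * fisher_deriv w y) = (\<lambda>y. - v2 y)"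
    using nz by (auto simp: F sq)
  have "((\<lambda>y. - v2 y) has_real_derivative - v3 x) (at x)"
    by (rule DERIV_minus[OF d(3)])
  then have 4: "deriv (\<lambda>y. sqrt (w y) * fisher_deriv w y) x = - v3 x"
    unfolding 3 by (rule DERIV_imp_deriv)
  show ?thesis
    unfolding 2 4 unfolding sq using nz[of x] by (simp add: field_simps power2_eq_square)
qed

section \<open>Convergence to equilibrium\<close>

text \<open>On the unit interval this is the nonnegativity of the variance of
  \<open>\<bar>f\<bar>\<close>.\<close>

lemma abs_integral_le_L2:
  fixes f :: "real \<Rightarrow> real"
  assumes "continuous_on {0..1} f"
  shows "(integral {0..1} (\<lambda>x. \<bar>f x\<bar>))\<^sup>2 \<le> integral {0..1} (\<lambda>x. (f x)\<^sup>2)"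
proof -
  let ?a = "integral {0..1} (\<lambda>x. \<bar>f x\<bar>)"
  have i: "(\<lambda>x. \<bar>f x\<bar>) integrable_on {0..1}" "(\<lambda>x. (f x)\<^sup>2) integrable_on {0..1}"
    using assms by (auto intro!: integrable_continuous_real continuous_intros)
  have "0 \<le> integral {0..1} (\<lambda>x. (\<bar>f x\<bar> - ?a)\<^sup>2)"
    using assms by (intro integral_nonneg integrable_continuous_real continuous_intros) auto
  also have "(\<lambda>x. (\<bar>f x\<bar> - ?a)\<^sup>2) = (\<lambda>x. (f x)\<^sup>2 - (2 * ?a) * \<bar>f x\<bar> + ?a\<^sup>2)"
    by (auto simp: power2_eq_square algebra_simps)
  also have "integral {0..1} \<dots> = integral {0..1} (\<lambda>x. (f x)\<^sup>2) - (2 * ?a) * ?a + measure lborel {0..1::real} *\<^sub>R ?a\<^sup>2"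
    by (intro integral_unique has_integral_add has_integral_diff has_integral_mult_right
        has_integral_const_real integrable_integral i)
  finally show ?thesis by (simp add: power2_eq_square)
qed

lemma integral_derivative_periodic:
  fixes p :: "real \<Rightarrow> real"
  assumes "\<And>x. (p has_real_derivative p' x) (at x)" "p 1 = p 0"
  shows "(p' has_integral 0) {0..1}"
proof -
  have "(p' has_integral (p 1 - p 0)) {0..1}"
    by (rule fundamental_theorem_of_calculus)
      (auto intro: has_field_derivative_at_within assms simp flip: has_real_derivative_iff_has_vector_derivative)
  then show ?thesis using assms by simp
qed

text \<open>All terms except \<open>- a (v2)^2 / v\<close> form the exact derivative of the periodic
  function \<open>P\<close>. The case \<open>a = 0\<close> is conservation of mass, the case
  \<open>a = c\<close> the decay of the distance to equilibrium.\<close>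

lemma energy_identity:
  fixes v :: "real \<Rightarrow> real"
  assumes pos: "\<And>x. 0 < v x" and per: "\<And>x. v (x + 1) = v x"
    and d: "\<And>x. (v has_real_derivative v1 x) (at x)" "\<And>x. (v1 has_real_derivative v2 x) (at x)"
      "\<And>x. (v2 has_real_derivative v3 x) (at x)" "\<And>x. (v3 has_real_derivative v4 x) (at x)"
  shows "((\<lambda>x. 2 * (v x - a) * (- 1/2 * v4 x + (v2 x)\<^sup>2 / (2 * v x) + \<delta> / 2 * v3 x))
     has_integral - a * integral {0..1} (\<lambda>x. (v2 x)\<^sup>2 / v x)) {0..1}"
proof -
  have nz: "v x \<noteq> 0" for x using pos[of x] by simp
  have cont: "continuous_on {0..1} v" "continuous_on {0..1} v2"
    by (rule DERIV_continuous_on[OF has_field_derivative_at_within[OF d(1)]]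
        DERIV_continuous_on[OF has_field_derivative_at_within[OF d(3)]])+
  note p1 = periodic_derivative[OF per d(1)]
  note p2 = periodic_derivative[OF p1 d(2)]
  note p3 = periodic_derivative[OF p2 d(3)]
  have p: "v 1 = v 0" "v1 1 = v1 0" "v2 1 = v2 0" "v3 1 = v3 0"
    using per[of 0] p1[of 0] p2[of 0] p3[of 0] by simp_all
  define P where "P = (\<lambda>x. - (v x * v3 x) + v1 x * v2 x + a * v3 x + \<delta> * (v x * v2 x - (v1 x)\<^sup>2 / 2 - a * v2 x))"
  define Q where "Q = (\<lambda>x. - (v x * v4 x) + (v2 x)\<^sup>2 + a * v4 x + \<delta> * (v x * v3 x - a * v3 x))"
  have "(P has_real_derivative Q x) (at x)" for x
    unfolding P_def Q_def
    by (auto intro!: derivative_eq_intros d simp: algebra_simps power2_eq_square)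
  then have "(Q has_integral 0) {0..1}"
    by (rule integral_derivative_periodic) (simp add: P_def p)
  moreover have "((\<lambda>x. (v2 x)\<^sup>2 / v x) has_integral integral {0..1} (\<lambda>x. (v2 x)\<^sup>2 / v x)) {0..1}"
    using cont nz by (intro integrable_integral integrable_continuous_real continuous_intros) auto
  ultimately have "((\<lambda>x. Q x + - a * ((v2 x)\<^sup>2 / v x)) has_integral
      0 + - a * integral {0..1} (\<lambda>x. (v2 x)\<^sup>2 / v x)) {0..1}"
    by (intro has_integral_add has_integral_mult_right)
  moreover have "(\<lambda>x. Q x + - a * ((v2 x)\<^sup>2 / v x))
      = (\<lambda>x. 2 * (v x - a) * (- 1/2 * v4 x + (v2 x)\<^sup>2 / (2 * v x) + \<delta> / 2 * v3 x))"
    using nz by (auto simp: Q_def field_simps power2_eq_square)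
  ultimately show ?thesis by simp
qed

text \<open>A Poincare inequality in which the constant \<open>c\<close> is the quadratic mean; since \<open>c\<close> lies between
  the minimum and the maximum of \<open>v\<close>, it suffices to bound the oscillation.\<close>

lemma poincare_quadratic_mean:
  fixes v :: "real \<Rightarrow> real"
  assumes v: "\<And>x. 0 \<le> v x" "v 1 = v 0" and c: "0 \<le> c" "integral {0..1} (\<lambda>x. (v x)\<^sup>2) = c\<^sup>2"
    and d: "\<And>x. (v has_real_derivative v1 x) (at x)" "\<And>x. (v1 has_real_derivative v2 x) (at x)"
    and v2: "continuous_on {0..1} v2"
  shows "integral {0..1} (\<lambda>x. (v x - c)\<^sup>2) \<le> integral {0..1} (\<lambda>x. (v2 x)\<^sup>2)"
proof -
  define a where "a = integral {0..1} (\<lambda>x. \<bar>v2 x\<bar>)"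
  have cont: "continuous_on {0..1} v"
    by (rule DERIV_continuous_on[OF has_field_derivative_at_within[OF d(1)]])
  have int2: "(\<lambda>x. \<bar>v2 x\<bar>) integrable_on {0..1}"
    using v2 by (intro integrable_continuous_real continuous_intros)
  have a0: "0 \<le> a" unfolding a_def by (rule integral_nonneg[OF int2]) simp
  \<comment> \<open>Periodicity gives a critical point; integrating \<open>v2\<close> from it bounds
    \<open>v1\<close>, and hence the oscillation of \<open>v\<close>, by \<open>a\<close>.\<close>
  obtain z where z: "0 < z" "z < 1" "v1 z = 0"
    using Rolle[of 0 1 v] v(2) cont d(1) DERIV_unique real_differentiable_def
    by (metis zero_less_one)
  have ftc: "\<bar>v1 y - v1 x\<bar> \<le> a" if "0 \<le> x" "x \<le> y" "y \<le> 1" for x y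
  proof -
    have "(v2 has_integral (v1 y - v1 x)) {x..y}"
      using that by (intro fundamental_theorem_of_calculus)
        (auto intro: has_field_derivative_at_within d simp flip: has_real_derivative_iff_has_vector_derivative)
    then have "v1 y - v1 x = integral {x..y} v2" "v2 integrable_on {x..y}"
      by (auto simp: integral_unique has_integral_integrable)
    moreover have "norm (integral {x..y} v2) \<le> integral {x..y} (\<lambda>x. \<bar>v2 x\<bar>)"
      using that v2 by (intro integral_norm_bound_integral integrable_continuous_real continuous_intros)
        (auto intro: continuous_on_subset)
    moreover have "integral {x..y} (\<lambda>x. \<bar>v2 x\<bar>) \<le> a"
      unfolding a_def using that int2
      by (intro integral_subset_le) (auto intro: integrable_on_subinterval)
    ultimately show ?thesis by simp
  qed
  have v1: "\<bar>v1 x\<bar> \<le> a" if "x \<in> {0..1}" for x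
    using ftc[of x z] ftc[of z x] z that by (cases "x \<le> z") auto
  have osc: "\<bar>v x - v y\<bar> \<le> a" if "x \<in> {0..1}" "y \<in> {0..1}" for x y
  proof -
    have "norm (v x - v y) \<le> a * norm (x - y)"
      by (rule field_differentiable_bound[of "{0..1}" v v1])
        (use that v1 d(1) in \<open>auto intro: has_field_derivative_at_within\<close>)
    also have "\<dots> \<le> a * 1" using that a0 by (intro mult_left_mono) auto
    finally show ?thesis by simp
  qed
  have int: "(\<lambda>x. (v x)\<^sup>2) integrable_on {0..1}"
    using cont by (intro integrable_continuous_real continuous_intros)
  have near: "\<bar>v x - c\<bar> \<le> a" if x: "x \<in> {0..1}" for x
  proof -
    have "v x - a \<le> c"
    proof (rule ccontr)
      assume *: "\<not> v x - a \<le> c"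
      have "(v x - a)\<^sup>2 \<le> (v y)\<^sup>2" if "y \<in> {0..1}" for y
        using osc[OF x that] * c(1) by (intro power_mono) auto
      then have "integral {0..1} (\<lambda>_::real. (v x - a)\<^sup>2) \<le> integral {0..1} (\<lambda>x. (v x)\<^sup>2)"
        using int by (intro integral_le) auto
      moreover have "c\<^sup>2 < (v x - a)\<^sup>2" using * c(1) by (intro power_strict_mono) auto
      ultimately show False by (simp add: c(2))
    qed
    moreover have "c \<le> v x + a"
    proof (rule ccontr)
      assume *: "\<not> c \<le> v x + a"
      have "(v y)\<^sup>2 \<le> (v x + a)\<^sup>2" if "y \<in> {0..1}" for y
        using osc[OF x that] v(1)[of y] by (intro power_mono) auto
      then have "integral {0..1} (\<lambda>x. (v x)\<^sup>2) \<le> integral {0..1} (\<lambda>_::real. (v x + a)\<^sup>2)"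
        using int by (intro integral_le) auto
      moreover have "(v x + a)\<^sup>2 < c\<^sup>2" using * v(1)[of x] a0 by (intro power_strict_mono) auto
      ultimately show False by (simp add: c(2))
    qed
    ultimately show ?thesis by linarith
  qed
  have "integral {0..1} (\<lambda>x. (v x - c)\<^sup>2) \<le> integral {0..1} (\<lambda>_::real. a\<^sup>2)"
  proof (rule integral_le)
    show "(\<lambda>x. (v x - c)\<^sup>2) integrable_on {0..1}"
      using cont by (intro integrable_continuous_real continuous_intros)
    show "(v x - c)\<^sup>2 \<le> a\<^sup>2" if "x \<in> {0..1}" for x
      using near[OF that] a0 abs_le_square_iff[of "v x - c" a] by simp
  qed auto
  also have "\<dots> = a\<^sup>2" by simp
  also have "\<dots> \<le> integral {0..1} (\<lambda>x. (v2 x)\<^sup>2)"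
    unfolding a_def by (rule abs_integral_le_L2[OF v2])
  finally show ?thesis .
qed

text \<open>On an interval of length \<open>s\<close> around or beside \<open>x\<close> the function
  stays above \<open>\<bar>f x\<bar> - K * s\<close> in modulus, so its integral there is at least
  \<open>s\<close> times this. The bound \<open>s \<le> 1/2\<close> leaves room inside
  \<open>{0..1}\<close> on one side of \<open>x\<close>.\<close>

lemma lipschitz_sup_le_L1:
  fixes f :: "real \<Rightarrow> real"
  assumes lip: "\<And>x y. \<bar>f x - f y\<bar> \<le> K * \<bar>x - y\<bar>" and cont: "continuous_on {0..1} f"
    and s: "0 < s" "s \<le> 1/2" and x: "x \<in> {0..1}"
  shows "\<bar>f x\<bar> \<le> integral {0..1} (\<lambda>x. \<bar>f x\<bar>) / s + K * s"
proof -
  define b where "b = (if x \<le> 1/2 then x else x - s)"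
  have b: "{b..b + s} \<subseteq> {0..1}" and xb: "x \<in> {b..b + s}"
    using x s by (auto simp: b_def split: if_splits)
  have K: "0 \<le> K" using lip[of 1 0] by simp
  have int: "(\<lambda>x. \<bar>f x\<bar>) integrable_on {0..1}"
    using cont by (intro integrable_continuous_real continuous_intros)
  have "s * (\<bar>f x\<bar> - K * s) = integral {b..b + s} (\<lambda>_. \<bar>f x\<bar> - K * s)"
    using s by simp
  also have "\<dots> \<le> integral {b..b + s} (\<lambda>x. \<bar>f x\<bar>)"
  proof (rule integral_le)
    show "(\<lambda>x. \<bar>f x\<bar>) integrable_on {b..b + s}"
      by (rule integrable_on_subinterval[OF int b])
    fix y assume y: "y \<in> {b..b + s}"
    have "\<bar>x - y\<bar> \<le> s" using xb y by auto
    then have "K * \<bar>x - y\<bar> \<le> K * s" using K by (intro mult_left_mono)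
    then show "\<bar>f x\<bar> - K * s \<le> \<bar>f y\<bar>" using lip[of x y] by linarith
  qed auto
  also have "\<dots> \<le> integral {0..1} (\<lambda>x. \<bar>f x\<bar>)"
    using b int integrable_on_subinterval[OF int b] by (intro integral_subset_le) auto
  finally have "\<bar>f x\<bar> - K * s \<le> integral {0..1} (\<lambda>x. \<bar>f x\<bar>) / s"
    using s by (simp add: le_divide_eq mult.commute)
  then show ?thesis by simp
qed

lemma exp_decay_of_differential_inequality:
  fixes f :: "real \<Rightarrow> real"
  assumes "0 \<le> T" and d: "\<And>t. t \<in> {0..T} \<Longrightarrow> (f has_real_derivative f' t) (at t within {0..T})"
    and le: "\<And>t. t \<in> {0..T} \<Longrightarrow> f' t \<le> - r * f t"
  shows "f T \<le> f 0 * exp (- r * T)"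
proof -
  let ?g = "\<lambda>t. exp (r * t) * f t"
  have g: "(?g has_real_derivative exp (r * t) * (r * f t + f' t)) (at t within {0..T})"
    if "t \<in> {0..T}" for t
    by (rule derivative_eq_intros refl d[OF that])+ (simp add: algebra_simps)
  have "?g T \<le> ?g 0"
  proof (rule DERIV_nonpos_imp_decreasing_open[OF \<open>0 \<le> T\<close>])
    show "continuous_on {0..T} ?g"
      by (rule DERIV_continuous_on) (rule g)
    fix t assume t: "0 < t" "t < T"
    then have "(?g has_real_derivative exp (r * t) * (r * f t + f' t)) (at t)"
      using g[of t] by (simp add: at_within_Icc_at)
    moreover have "exp (r * t) * (r * f t + f' t) \<le> 0"
      using le[of t] t by (intro mult_nonneg_nonpos) auto
    ultimately show "\<exists>y. (?g has_real_derivative y) (at t) \<and> y \<le> 0" by blast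
  qed
  then have "exp (- (r * T)) * (exp (r * T) * f T) \<le> exp (- (r * T)) * f 0"
    by (intro mult_left_mono) auto
  then show ?thesis
    by (simp add: exp_minus field_simps)
qed

section \<open>One-sided time derivatives, and positivity on compact intervals\<close>

lemma time_intervalD:
  assumes "time_interval I"
  shows "convex I" "connected I" "I \<subseteq> {0..}" "0 \<in> I" "I \<noteq> {x}"
    "t \<in> I \<Longrightarrow> 0 \<le> s \<Longrightarrow> s \<le> t \<Longrightarrow> s \<in> I"
proof -
  show 1: "convex I" using assms by (auto simp: time_interval_def)
  then show "connected I" by (rule convex_connected)
  show "I \<subseteq> {0..}" "0 \<in> I" "t \<in> I \<Longrightarrow> 0 \<le> s \<Longrightarrow> s \<le> t \<Longrightarrow> s \<in> I"
    using assms by (auto simp: time_interval_def)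
  have "\<exists>t>0. {0, t} \<subseteq> I"
    using assms by (auto simp: time_interval_def intro: exI[of _ 1])
  then show "I \<noteq> {x}" by auto
qed

text \<open>A connected set with more than one point has no isolated points. This identifies the
  time derivative provided by smoothness with the one prescribed by the equation, also at the end
  points.\<close>

lemma DERIV_unique_time_interval:
  assumes "time_interval I" "t \<in> I"
    and "(f has_real_derivative D) (at t within I)" "(f has_real_derivative D') (at t within I)"
  shows "D = D'"
proof -
  have "t islimpt I"
    by (rule connected_imp_perfect) (use time_intervalD[OF assms(1)] assms(2) in auto)
  then have "at t within I \<noteq> bot" by (simp add: trivial_limit_within)
  then show ?thesis
    using assms(3,4) vector_derivative_unique_within
    unfolding has_real_derivative_iff_has_vector_derivative by blast
qed

lemma pde_solution_subset:
  assumes "pde_solution \<delta> I u" "J \<subseteq> I"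
  shows "pde_solution \<delta> J u"
  using assms unfolding pde_solution_def by (meson DERIV_subset subsetD)

lemma pde_solutionD:
  assumes "pde_solution \<delta> I u" "t \<in> I"
  shows "0 < u t x" "u t (x + 1) = u t x"
  using assms by (auto simp: pde_solution_def)

lemma pde_solution_sqrt:
  assumes I: "time_interval I" and pde: "pde_solution \<delta> I u" and t: "t \<in> I"
    and vt: "((\<lambda>s. sqrt (u s x)) has_real_derivative vt) (at t within I)"
    and d: "\<And>x. ((\<lambda>y. sqrt (u t y)) has_real_derivative v1 x) (at x)" "\<And>x. (v1 has_real_derivative v2 x) (at x)"
      "\<And>x. (v2 has_real_derivative v3 x) (at x)" "\<And>x. (v3 has_real_derivative v4 x) (at x)"
  shows "vt = - 1/2 * v4 x + (v2 x)\<^sup>2 / (2 * sqrt (u t x)) + \<delta> / 2 * v3 x"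
proof -
  note pos = pde_solutionD(1)[OF pde t]
  have "((\<lambda>s. sqrt (u s x)) has_real_derivative
      (1 / (2 * sqrt (u t x)) * deriv (\<lambda>y. u t y * deriv (fisher_deriv (u t)) y) x
           - \<delta> / 2 * deriv (\<lambda>y. sqrt (u t y) * fisher_deriv (u t) y) x)) (at t within I)"
    using pde t unfolding pde_solution_def by blast
  with vt have "vt = 1 / (2 * sqrt (u t x)) * deriv (\<lambda>y. u t y * deriv (fisher_deriv (u t)) y) x
           - \<delta> / 2 * deriv (\<lambda>y. sqrt (u t y) * fisher_deriv (u t) y) x"
    by (rule DERIV_unique_time_interval[OF I t])
  also have "\<dots> = - 1/2 * v4 x + (v2 x)\<^sup>2 / (2 * sqrt (u t x)) + \<delta> / 2 * v3 x"
    by (rule pde_rhs_eq[OF _ _ d]) (use pos in \<open>simp_all add: less_imp_le\<close>)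
  finally show ?thesis .
qed

lemma positive_lower_bound:
  assumes u: "bounded_continuous {0..T} u" and T: "0 \<le> T"
    and pos: "\<And>t x. t \<in> {0..T} \<Longrightarrow> 0 < u t x" and per: "\<And>t x. t \<in> {0..T} \<Longrightarrow> u t (x + 1) = u t x"
  obtains \<epsilon> :: real where "0 < \<epsilon>" "\<And>t x. t \<in> {0..T} \<Longrightarrow> \<epsilon> \<le> u t x"
proof -
  have "continuous_on ({0..T} \<times> {0..1}) (\<lambda>(t, x). u t x)"
    using u unfolding bounded_continuous_iff by (auto intro: continuous_on_subset)
  then obtain p where p: "p \<in> {0..T} \<times> {0..1}"
    "\<forall>q\<in>{0..T} \<times> {0..1}. (\<lambda>(t, x). u t x) p \<le> (\<lambda>(t, x). u t x) q"
    using continuous_attains_inf[of "{0..T} \<times> {0..1::real}" "\<lambda>(t, x). u t x"] T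
    by (auto simp: compact_Times)
  show thesis
  proof (rule that)
    show "0 < u (fst p) (snd p)" using p(1) by (intro pos) auto
    show "u (fst p) (snd p) \<le> u t x" if "t \<in> {0..T}" for t x
    proof -
      have "u (fst p) (snd p) \<le> u t (frac x)"
        using bspec[OF p(2), of "(t, frac x)"] that by (auto simp: case_prod_beta frac_lt_1 less_imp_le)
      then show ?thesis using periodic_frac[of "u t" x] per[OF that] by simp
    qed
  qed
qed

lemma continuous_on_slice:
  assumes "bounded_continuous I f" "t \<in> I"
  shows "continuous_on A (f t)"
proof -
  have "continuous_on A ((\<lambda>(t, x). f t x) \<circ> (\<lambda>x. (t, x)))"
    using assms unfolding bounded_continuous_iff
    by (intro continuous_on_compose continuous_intros) (auto intro: continuous_on_subset)
  then show ?thesis by (simp add: comp_def)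
qed

text \<open>By \<open>energy_identity\<close> the energy has derivative \<open>- c * D t\<close>;
  the upper bound \<open>M\<close> of \<open>v\<close> removes the denominator in
  \<open>D t\<close>, and the Poincare inequality closes the differential inequality. A lower bound
  of \<open>u\<close> on the compact interval serves only to make \<open>v\<close> smooth and does
  not enter the estimate.\<close>

lemma energy_decay:
  fixes u :: "real \<Rightarrow> real \<Rightarrow> real"
  assumes T: "0 < T" and u: "smooth_upto {0..T} 4 u" and pde: "pde_solution \<delta> {0..T} u"
    and M: "0 < M" "\<And>t x. t \<in> {0..T} \<Longrightarrow> u t x \<le> M\<^sup>2"
    and c: "0 \<le> c" "integral {0..1} (u 0) = c\<^sup>2"
  shows "integral {0..1} (\<lambda>x. (sqrt (u T x) - c)\<^sup>2)
    \<le> integral {0..1} (\<lambda>x. (sqrt (u 0 x) - c)\<^sup>2) * exp (- (c / M) * T)"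
proof -
  let ?I = "{0..T}"
  have I: "time_interval ?I" using T by (auto simp: time_interval_def)
  define v where "v = (\<lambda>t x. sqrt (u t x))"
  have pos: "0 < u t x" "0 < v t x" if "t \<in> ?I" for t x
    using pde_solutionD(1)[OF pde that] by (auto simp: v_def)
  have per: "v t (x + 1) = v t x" if "t \<in> ?I" for t x
    using pde_solutionD(2)[OF pde that] by (auto simp: v_def)
  obtain \<epsilon> where "0 < \<epsilon>" "\<And>t x. t \<in> ?I \<Longrightarrow> \<epsilon> \<le> u t x"
    by (rule positive_lower_bound[OF smooth_upto_imp_bounded_continuous[OF u] less_imp_le[OF T]
          pde_solutionD[OF pde]]) (blast intro: that)+
  then have v: "smooth_upto ?I 4 v"
    unfolding v_def using u by (rule smooth_upto_sqrt)
  have num: "4 = Suc (Suc (Suc (Suc 0)))" by simp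
  obtain vt v1 where v1:
    "\<And>t x. t \<in> ?I \<Longrightarrow> ((\<lambda>s. v s x) has_real_derivative vt t x) (at t within ?I)"
    "\<And>t x. t \<in> ?I \<Longrightarrow> (v t has_real_derivative v1 t x) (at x)"
    "smooth_upto ?I (Suc (Suc (Suc 0))) vt" "smooth_upto ?I (Suc (Suc (Suc 0))) v1"
    using v[unfolded num] by (rule smooth_upto_SucE) (rule that)
  obtain v2 where v2:
    "\<And>t x. t \<in> ?I \<Longrightarrow> (v1 t has_real_derivative v2 t x) (at x)" "smooth_upto ?I (Suc (Suc 0)) v2"
    using v1(4) by (rule smooth_upto_SucE) (rule that)
  obtain v3 where v3:
    "\<And>t x. t \<in> ?I \<Longrightarrow> (v2 t has_real_derivative v3 t x) (at x)" "smooth_upto ?I (Suc 0) v3"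
    using v2(2) by (rule smooth_upto_SucE) (rule that)
  obtain v4 where v4:
    "\<And>t x. t \<in> ?I \<Longrightarrow> (v3 t has_real_derivative v4 t x) (at x)"
    using v3(2) by (rule smooth_upto_SucE) (rule that)
  note bc = v[THEN smooth_upto_imp_bounded_continuous] v1(3)[THEN smooth_upto_imp_bounded_continuous]
  have vt: "vt t x = - 1/2 * v4 t x + (v2 t x)\<^sup>2 / (2 * v t x) + \<delta> / 2 * v3 t x" if "t \<in> ?I" for t x
    using pde_solution_sqrt[OF I pde that, of x "vt t x" "v1 t" "v2 t" "v3 t" "v4 t"] v1(1,2)[OF that] v2(1)[OF that]
      v3(1)[OF that] v4[OF that] unfolding v_def by blast
  define D where "D = (\<lambda>t. integral {0..1} (\<lambda>x. (v2 t x)\<^sup>2 / v t x))"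
  have E: "((\<lambda>t. integral {0..1} (\<lambda>x. (v t x - a)\<^sup>2)) has_real_derivative - a * D t) (at t within ?I)"
    if t: "t \<in> ?I" for t a
  proof -
    have "((\<lambda>t. integral (cbox 0 1) (\<lambda>x. (v t x - a)\<^sup>2)) has_field_derivative
        integral (cbox 0 1) (\<lambda>x. 2 * (v t x - a) * vt t x)) (at t within ?I)"
    proof (rule leibniz_rule_field_derivative[where f = "\<lambda>t x. (v t x - a)\<^sup>2"])
      show "((\<lambda>t. (v t x - a)\<^sup>2) has_field_derivative 2 * (v t x - a) * vt t x) (at t within ?I)"
        if "t \<in> ?I" for t x
        using DERIV_power[OF DERIV_diff[OF v1(1)[OF that] DERIV_const], of x a 2] by (simp add: algebra_simps)
      show "(\<lambda>x. (v t x - a)\<^sup>2) integrable_on cbox 0 1" if "t \<in> ?I" for t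
        unfolding interval_cbox[symmetric]
        by (intro integrable_continuous_real continuous_intros continuous_on_slice[OF bc(1) that])
      show "continuous_on (?I \<times> cbox 0 1) (\<lambda>(t, x). 2 * (v t x - a) * vt t x)"
      proof -
        have "continuous_on (?I \<times> cbox 0 1) (\<lambda>(t, x). v t x)" "continuous_on (?I \<times> cbox 0 1) (\<lambda>(t, x). vt t x)"
          using bc unfolding bounded_continuous_iff by (auto intro: continuous_on_subset)
        then show ?thesis unfolding case_prod_beta by (intro continuous_intros)
      qed
    qed (use t in auto)
    moreover have "integral (cbox 0 1) (\<lambda>x. 2 * (v t x - a) * vt t x) = - a * D t"
      unfolding vt[OF t] D_def interval_cbox[symmetric]
      by (rule integral_unique) (rule energy_identity[OF pos(2)[OF t] per[OF t] v1(2)[OF t] v2(1)[OF t] v3(1)[OF t] v4[OF t]])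
    ultimately show ?thesis by simp
  qed
  have sq: "(v t x)\<^sup>2 = u t x" if "t \<in> ?I" for t x
    using pos(1)[OF that, of x] by (simp add: v_def)
  have mass: "integral {0..1} (\<lambda>x. (v t x)\<^sup>2) = c\<^sup>2" if "t \<in> ?I" for t
  proof -
    \<comment> \<open>For \<open>a = 0\<close> the derivative in \<open>E\<close> is zero:
      \<open>c\<close> remains the quadratic mean of \<open>v\<close> at all times, as the Poincare
      inequality demands.\<close>
    have "\<exists>m. \<forall>t\<in>?I. integral {0..1} (\<lambda>x. (v t x - 0)\<^sup>2) = m"
      by (rule has_field_derivative_zero_constant) (use E[of _ 0] in auto)
    then have "integral {0..1} (\<lambda>x. (v t x)\<^sup>2) = integral {0..1} (\<lambda>x. (v 0 x)\<^sup>2)"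
      using that T by (metis (no_types, lifting) atLeastAtMost_iff diff_zero integral_cong less_imp_le order_refl)
    also have "(\<lambda>x. (v 0 x)\<^sup>2) = u 0" using sq[of 0] T by auto
    finally show ?thesis by (simp add: c(2))
  qed
  have "integral {0..1} (\<lambda>x. (v T x - c)\<^sup>2) \<le> integral {0..1} (\<lambda>x. (v 0 x - c)\<^sup>2) * exp (- (c / M) * T)"
  proof (rule exp_decay_of_differential_inequality[where f = "\<lambda>t. integral {0..1} (\<lambda>x. (v t x - c)\<^sup>2)"])
    fix t assume t: "t \<in> ?I"
    show "((\<lambda>t. integral {0..1} (\<lambda>x. (v t x - c)\<^sup>2)) has_real_derivative - c * D t) (at t within ?I)"
      by (rule E[OF t])
    have cont2: "continuous_on {0..1} (v2 t)"
      by (rule DERIV_continuous_on[OF has_field_derivative_at_within[OF v3(1)[OF t]]])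
    have "integral {0..1} (\<lambda>x. (v t x - c)\<^sup>2) \<le> integral {0..1} (\<lambda>x. (v2 t x)\<^sup>2)"
      by (rule poincare_quadratic_mean[OF _ _ c(1) mass[OF t] v1(2)[OF t] v2(1)[OF t] cont2])
        (use pos(2)[OF t] per[OF t, of 0] in \<open>auto intro: less_imp_le\<close>)
    also have "\<dots> \<le> integral {0..1} (\<lambda>x. M * ((v2 t x)\<^sup>2 / v t x))"
    proof (rule integral_le)
      have nz: "v t x \<noteq> 0" for x using pos(2)[OF t, of x] by simp
      show "(\<lambda>x. (v2 t x)\<^sup>2) integrable_on {0..1}"
        using cont2 by (intro integrable_continuous_real continuous_intros)
      show "(\<lambda>x. M * ((v2 t x)\<^sup>2 / v t x)) integrable_on {0..1}"
        using cont2 continuous_on_slice[OF bc(1) t] nz by (intro integrable_continuous_real continuous_intros) auto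
      show "(v2 t x)\<^sup>2 \<le> M * ((v2 t x)\<^sup>2 / v t x)" for x
      proof -
        have "v t x \<le> M" using M(2)[OF t, of x] M(1) by (auto simp: v_def intro: real_le_lsqrt)
        then have "(v2 t x)\<^sup>2 * v t x \<le> (v2 t x)\<^sup>2 * M" by (intro mult_left_mono) auto
        then show ?thesis using pos(2)[OF t, of x] by (simp add: field_simps)
      qed
    qed
    also have "\<dots> = M * D t"
      unfolding D_def by (rule integral_mult_right)
    finally have "integral {0..1} (\<lambda>x. (v t x - c)\<^sup>2) \<le> M * D t" .
    then have "(c / M) * integral {0..1} (\<lambda>x. (v t x - c)\<^sup>2) \<le> (c / M) * (M * D t)"
      using c(1) M(1) by (intro mult_left_mono) auto
    then show "- c * D t \<le> - (c / M) * integral {0..1} (\<lambda>x. (v t x - c)\<^sup>2)"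
      using M(1) by simp
  qed (use T in simp)
  then show ?thesis by (simp add: v_def)
qed

text \<open>Stated for \<open>u\<close> and not for its square root, because the passage from
  mean-square to uniform decay uses a Lipschitz constant, and so far only that of \<open>u\<close>
  is uniform in time.\<close>

lemma half_line_decay:
  fixes u :: "real \<Rightarrow> real \<Rightarrow> real"
  assumes u: "smooth_upto {0..} 4 u" and pde: "pde_solution \<delta> {0..} u"
  obtains c C \<mu> where "0 < c" "0 < \<mu>" "\<And>t x. 0 \<le> t \<Longrightarrow> \<bar>u t x - c\<^sup>2\<bar> \<le> C * exp (- \<mu> * t)"
proof -
  have u': "smooth_upto {0..T} 4 u" and pde': "pde_solution \<delta> {0..T} u" for T
    by (rule smooth_upto_subset[OF _ u], simp) (rule pde_solution_subset[OF pde], simp)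
  have bc: "bounded_continuous {0..} u"
    using u by (rule smooth_upto_imp_bounded_continuous)
  have pos: "0 < u t x" and per: "u t (x + 1) = u t x" if "0 \<le> t" for t x
    using pde_solutionD[OF pde] that by auto
  obtain Kb where Kb: "\<And>t x. 0 \<le> t \<Longrightarrow> \<bar>u t x\<bar> \<le> Kb"
    using bc unfolding bounded_continuous_iff by auto
  \<comment> \<open>At least 1, so that \<open>M \<le> M\<^sup>2\<close> and \<open>M\<close> bounds
    both \<open>u\<close> and \<open>sqrt u\<close> suitably.\<close>
  define M where "M = max 1 Kb"
  have M0: "0 < M" by (simp add: M_def)
  have M: "u t x \<le> M\<^sup>2" if "0 \<le> t" for t x
  proof -
    have "u t x \<le> M" using Kb[OF that, of x] by (simp add: M_def)
    also have "M \<le> M\<^sup>2" by (rule self_le_power) (auto simp: M_def)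
    finally show "u t x \<le> M\<^sup>2" .
  qed
  have num: "4 = Suc (Suc (Suc (Suc 0)))" by simp
  obtain ux where ux:
    "\<And>t x. t \<in> {0..} \<Longrightarrow> (u t has_real_derivative ux t x) (at x)" "smooth_upto {0..} (Suc (Suc (Suc 0))) ux"
    using u[unfolded num] by (rule smooth_upto_SucE) (rule that)
  obtain K where K: "\<And>t x. t \<in> {0..} \<Longrightarrow> \<bar>ux t x\<bar> \<le> K"
    using smooth_upto_imp_bounded_continuous[OF ux(2)] unfolding bounded_continuous_iff by blast
  have lip: "\<bar>u t x - u t y\<bar> \<le> K * \<bar>x - y\<bar>" if "0 \<le> t" for t x y
    using field_differentiable_bound[of UNIV "u t" "ux t" K x y] ux(1)[of t] K[of t] that by auto
  have cont: "continuous_on {0..1} (u t)" if "0 \<le> t" for t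
    using continuous_on_slice[OF bc] that by simp
  \<comment> \<open>Positivity at the initial time makes \<open>c\<close>, and with it the rate
    \<open>c / M\<close>, positive.\<close>
  obtain \<epsilon> where \<epsilon>: "0 < \<epsilon>" "\<And>x. \<epsilon> \<le> u 0 x"
  proof (rule positive_lower_bound[OF smooth_upto_imp_bounded_continuous[OF u'[of 0]] order_refl
        pde_solutionD[OF pde'[of 0]]], assumption, assumption)
    fix \<epsilon> :: real assume "0 < \<epsilon>" "\<And>t x. t \<in> {0..0} \<Longrightarrow> \<epsilon> \<le> u t x"
    then show thesis by (intro that[of \<epsilon>]) auto
  qed
  define c where "c = sqrt (integral {0..1} (u 0))"
  have "integral {0..1} (\<lambda>_::real. \<epsilon>) \<le> integral {0..1} (u 0)"
    using cont[of 0] \<epsilon>(2) by (intro integral_le integrable_continuous_real) auto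
  with \<epsilon>(1) have c: "0 < c" "integral {0..1} (u 0) = c\<^sup>2" by (auto simp: c_def)
  have cM: "c \<le> M"
  proof -
    have "integral {0..1} (u 0) \<le> integral {0..1} (\<lambda>_::real. M\<^sup>2)"
      using cont[of 0] M[of 0] by (intro integral_le integrable_continuous_real) auto
    then show ?thesis using power2_le_imp_le[of c M] M0 unfolding c(2) by simp
  qed
  define r where "r = c / M"
  have r: "0 < r" using c M0 by (simp add: r_def)
  define E where "E = (\<lambda>t. integral {0..1} (\<lambda>x. (sqrt (u t x) - c)\<^sup>2))"
  have E0: "0 \<le> E 0"
    unfolding E_def using cont[of 0] by (intro integral_nonneg integrable_continuous_real continuous_intros) auto
  have E: "E t \<le> E 0 * exp (- r * t)" if "0 \<le> t" for t
  proof (cases "t = 0")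
    case False
    with that show ?thesis
      unfolding E_def r_def
      using energy_decay[of t u \<delta> M c, OF _ u' pde' M0 M _ c(2)] c(1) by simp
  qed simp
  define C where "C = 4 * M * sqrt (E 0) + K / 2"
  have main: "\<bar>u t x - c\<^sup>2\<bar> \<le> C * exp (- (r / 4) * t)" if t: "0 \<le> t" and x: "x \<in> {0..1}" for t x
  proof -
    \<comment> \<open>The energy decays like \<open>q^4\<close>, so the integral of
      \<open>\<bar>u - c\<^sup>2\<bar>\<close> decays like \<open>q^2\<close>; on an interval of
      length \<open>q / 2\<close> both terms of \<open>lipschitz_sup_le_L1\<close> are then of order
      \<open>q\<close>.\<close>
    define q where "q = exp (- (r / 4) * t)"
    have q: "0 < q" "q \<le> 1" using t r by (auto simp: q_def)
    have q4: "exp (- r * t) = (q\<^sup>2)\<^sup>2"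
      by (simp add: q_def power2_eq_square flip: exp_add)
    have vle: "sqrt (u t y) \<le> M" for y
      using M[OF t, of y] M0 by (auto intro: real_le_lsqrt)
    have contv: "continuous_on {0..1} (\<lambda>y. sqrt (u t y) - c)"
      using cont[OF t] by (intro continuous_intros)
    have "integral {0..1} (\<lambda>y. \<bar>sqrt (u t y) - c\<bar>) \<le> sqrt (E 0) * q\<^sup>2"
    proof (rule power2_le_imp_le)
      have "(integral {0..1} (\<lambda>y. \<bar>sqrt (u t y) - c\<bar>))\<^sup>2 \<le> E t"
        unfolding E_def by (rule abs_integral_le_L2[OF contv])
      also have "\<dots> \<le> (sqrt (E 0) * q\<^sup>2)\<^sup>2"
        using E[OF t] E0 unfolding q4 by (simp add: power_mult_distrib)
      finally show "(integral {0..1} (\<lambda>y. \<bar>sqrt (u t y) - c\<bar>))\<^sup>2 \<le> (sqrt (E 0) * q\<^sup>2)\<^sup>2" .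
    qed (use E0 in simp)
    moreover have "integral {0..1} (\<lambda>y. \<bar>u t y - c\<^sup>2\<bar>) \<le> integral {0..1} (\<lambda>y. 2 * M * \<bar>sqrt (u t y) - c\<bar>)"
    proof (rule integral_le)
      show "(\<lambda>y. \<bar>u t y - c\<^sup>2\<bar>) integrable_on {0..1}"
        using cont[OF t] by (intro integrable_continuous_real continuous_intros)
      show "(\<lambda>y. 2 * M * \<bar>sqrt (u t y) - c\<bar>) integrable_on {0..1}"
        using cont[OF t] by (intro integrable_continuous_real continuous_intros)
      show "\<bar>u t y - c\<^sup>2\<bar> \<le> 2 * M * \<bar>sqrt (u t y) - c\<bar>" for y
      proof -
        have "(sqrt (u t y))\<^sup>2 = u t y" "0 \<le> sqrt (u t y)" using pos[OF t, of y] by auto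
        then have "\<bar>u t y - c\<^sup>2\<bar> = (sqrt (u t y) + c) * \<bar>sqrt (u t y) - c\<bar>"
          using c(1) abs_mult[of "sqrt (u t y) + c" "sqrt (u t y) - c"]
          by (simp add: power2_eq_square algebra_simps)
        also have "\<dots> \<le> 2 * M * \<bar>sqrt (u t y) - c\<bar>"
          using vle[of y] cM by (intro mult_right_mono) auto
        finally show ?thesis .
      qed
    qed
    ultimately have L1: "integral {0..1} (\<lambda>y. \<bar>u t y - c\<^sup>2\<bar>) \<le> 2 * M * (sqrt (E 0) * q\<^sup>2)"
      using M0 by (simp add: mult_left_mono order_trans)
    have "\<bar>u t x - c\<^sup>2\<bar> \<le> integral {0..1} (\<lambda>y. \<bar>u t y - c\<^sup>2\<bar>) / (q / 2) + K * (q / 2)"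
      by (rule lipschitz_sup_le_L1) (use lip[OF t] cont[OF t] q x in \<open>auto intro!: continuous_intros\<close>)
    also have "\<dots> \<le> 2 * M * (sqrt (E 0) * q\<^sup>2) / (q / 2) + K * (q / 2)"
      using L1 q by (intro add_mono divide_right_mono) auto
    also have "\<dots> = C * q" using q by (simp add: C_def power2_eq_square field_simps)
    finally show ?thesis by (simp add: q_def)
  qed
  show thesis
  proof (rule that)
    show "\<bar>u t x - c\<^sup>2\<bar> \<le> C * exp (- (r / 4) * t)" if "0 \<le> t" for t x
      using main[OF that, of "frac x"] periodic_frac[of "u t" x] per[OF that]
      by (simp add: frac_lt_1 less_imp_le)
  qed (use c r in auto)
qed

section \<open>Error estimate\<close>

text \<open>On a compact time interval this is plain boundedness and \<open>c = 0\<close> will do; on the half-line it is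
  the exponential convergence to equilibrium, which makes the error constant independent of time.\<close>

lemma sqrt_solution_regularity:
  fixes u :: "real \<Rightarrow> real \<Rightarrow> real"
  assumes I: "time_interval I" and u: "smooth_upto I 7 u" and pde: "pde_solution \<delta> I u"
  obtains \<epsilon> c C \<mu> :: real where "0 < \<epsilon>" "0 \<le> C" "0 < \<mu>" "\<And>t x. t \<in> I \<Longrightarrow> \<epsilon> \<le> sqrt (u t x)"
    "derivs_le I (\<lambda>t. C * exp (- \<mu> * t)) 6 (\<lambda>t x. sqrt (u t x) - c)"
proof -
  have seven: "7 = Suc 6" by simp
  show thesis
  proof (cases "I = {0..}")
    case False
    then obtain T where T: "0 < T" "I = {0..T}"
      using I by (auto simp: time_interval_def)
    obtain \<epsilon> where \<epsilon>: "0 < \<epsilon>" "\<And>t x. t \<in> {0..T} \<Longrightarrow> \<epsilon> \<le> u t x"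
      by (rule positive_lower_bound[OF smooth_upto_imp_bounded_continuous[OF u[unfolded T(2)]] less_imp_le[OF T(1)]
          pde_solutionD[OF pde[unfolded T(2)]]]) (blast intro: that)+
    have "smooth_upto I 7 (\<lambda>t x. sqrt (u t x))"
      by (rule smooth_upto_sqrt[OF \<epsilon>(1) _ u]) (use \<epsilon>(2) T(2) in blast)
    then have v: "smooth_upto I 6 (\<lambda>t x. sqrt (u t x))"
      unfolding seven by (rule smooth_upto_Suc_imp)
    obtain C where C: "0 \<le> C" "derivs_le I (\<lambda>_. C) 6 (\<lambda>t x. sqrt (u t x))"
      using smooth_upto_imp_derivs_le_const[OF v] by blast
    \<comment> \<open>A constant bound in the form of a decaying one:
      \<open>exp (T - t) \<ge> 1\<close> on the interval.\<close>
    have "derivs_le I (\<lambda>t. (C * exp T) * exp (- 1 * t)) 6 (\<lambda>t x. sqrt (u t x))"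
    proof (rule derivs_le_mono[OF _ C(2)])
      fix t assume "t \<in> I"
      then have "exp 0 \<le> exp (T + - 1 * t)" unfolding T(2) exp_le_cancel_iff by simp
      then have "C * 1 \<le> C * exp (T + - 1 * t)"
        using C(1) by (intro mult_left_mono) auto
      then show "C \<le> (C * exp T) * exp (- 1 * t)" unfolding exp_add by (simp add: mult.assoc)
    qed
    then have "derivs_le I (\<lambda>t. (C * exp T) * exp (- 1 * t)) 6 (\<lambda>t x. sqrt (u t x) - 0)"
      by simp
    then show thesis
      using \<epsilon> T(2) C(1) by (intro that[of "sqrt \<epsilon>" "C * exp T" 1 0]) auto
  next
    case True
    note u = u[unfolded True] and pde = pde[unfolded True]
    have u4: "smooth_upto {0..} 4 u"
    proof -
      have "7 = Suc (Suc (Suc 4))" by simp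
      then have "smooth_upto {0..} (Suc (Suc (Suc 4))) u" using u by metis
      then show ?thesis by (rule smooth_upto_Suc_imp[OF smooth_upto_Suc_imp[OF smooth_upto_Suc_imp]])
    qed
    obtain c C \<mu> where c: "0 < c" "0 < \<mu>" "\<And>t x. 0 \<le> t \<Longrightarrow> \<bar>u t x - c\<^sup>2\<bar> \<le> C * exp (- \<mu> * t)"
      by (rule half_line_decay[OF u4 pde]) (rule that)
    have C0: "0 \<le> C" using c(3)[of 0 0] by (auto intro: order_trans[OF abs_ge_zero])
    have pos: "0 < u t x" if "0 \<le> t" for t x
      using pde_solutionD(1)[OF pde] that by auto
    \<comment> \<open>From this time on \<open>C * exp (- \<mu> * t) \<le> c\<^sup>2 / 2\<close>, by
      \<open>x \<le> exp x\<close>, so that \<open>u \<ge> c\<^sup>2 / 2\<close>; before it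
      compactness gives the lower bound.\<close>
    define T where "T = 2 * C / (c\<^sup>2 * \<mu>)"
    have T: "0 \<le> T" using C0 c by (simp add: T_def)
    obtain \<epsilon> where \<epsilon>: "0 < \<epsilon>" "\<And>t x. t \<in> {0..T} \<Longrightarrow> \<epsilon> \<le> u t x"
    proof (rule positive_lower_bound[OF _ T])
      show "bounded_continuous {0..T} u"
        by (rule smooth_upto_imp_bounded_continuous[OF smooth_upto_subset[OF _ u]]) simp
    qed (use pde_solutionD[OF pde] that in auto)
    define \<epsilon>' where "\<epsilon>' = min \<epsilon> (c\<^sup>2 / 2)"
    have \<epsilon>'0: "0 < \<epsilon>'" using \<epsilon>(1) c(1) by (simp add: \<epsilon>'_def)
    have \<epsilon>': "\<epsilon>' \<le> u t x" if "0 \<le> t" for t x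
    proof (cases "t \<le> T")
      case True
      then show ?thesis using \<epsilon>(2)[of t x] that by (simp add: \<epsilon>'_def)
    next
      case False
      have "C * exp (- \<mu> * t) \<le> c\<^sup>2 / 2"
      proof -
        have "2 * C = (c\<^sup>2 * \<mu>) * T" using c by (simp add: T_def)
        also have "\<dots> \<le> (c\<^sup>2 * \<mu>) * t" using False c by (intro mult_left_mono) auto
        also have "\<dots> \<le> c\<^sup>2 * exp (\<mu> * t)"
        proof -
          have "\<mu> * t \<le> exp (\<mu> * t)" using exp_ge_add_one_self[of "\<mu> * t"] by linarith
          then show ?thesis unfolding mult.assoc by (intro mult_left_mono) auto
        qed
        finally show ?thesis by (simp add: exp_minus field_simps)
      qed
      moreover have "\<epsilon>' \<le> c\<^sup>2 / 2" by (simp add: \<epsilon>'_def)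
      ultimately show ?thesis using c(3)[OF that, of x] by linarith
    qed
    have v: "smooth_upto {0..} (Suc 6) (\<lambda>t x. sqrt (u t x) - c)"
    proof -
      have "smooth_upto {0..} 7 (\<lambda>t x. sqrt (u t x) + - c)"
        by (rule smooth_upto_add[OF smooth_upto_sqrt[OF \<epsilon>'0 _ u] smooth_upto_const]) (use \<epsilon>' in simp)
      then show ?thesis unfolding seven by (simp only: add_uminus_conv_diff)
    qed
    have "\<bar>sqrt (u t x) - c\<bar> \<le> (C / c) * exp (- \<mu> * t)" if "0 \<le> t" for t x
    proof -
      have sq: "(sqrt (u t x))\<^sup>2 = u t x" "0 \<le> sqrt (u t x)" using pos[OF that, of x] by auto
      have "c * \<bar>sqrt (u t x) - c\<bar> \<le> (sqrt (u t x) + c) * \<bar>sqrt (u t x) - c\<bar>"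
        using sq(2) by (intro mult_right_mono) auto
      also have "\<dots> = \<bar>u t x - c\<^sup>2\<bar>"
        using sq c(1) abs_mult[of "sqrt (u t x) + c" "sqrt (u t x) - c"]
        by (simp add: power2_eq_square algebra_simps)
      also have "\<dots> \<le> C * exp (- \<mu> * t)" by (rule c(3)[OF that])
      finally show ?thesis using c(1) by (simp add: field_simps)
    qed
    then obtain C' \<mu>' where "0 \<le> C'" "0 < \<mu>'"
      "derivs_le {0..} (\<lambda>t. C' * exp (- \<mu>' * t)) 6 (\<lambda>t x. sqrt (u t x) - c)"
      using smooth_upto_decay[OF v c(2)] by blast
    then show thesis
      using \<epsilon>'0 \<epsilon>' by (intro that[of "sqrt \<epsilon>'" C' \<mu>' c]) (auto simp: True)
  qed
qed

text \<open>The exponential factor is what makes \<open>\<tau>\<close> times the sum of the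
  residuals bounded independently of the number of steps.\<close>

lemma consistency_with_decay:
  fixes u :: "real \<Rightarrow> real \<Rightarrow> real"
  assumes I: "time_interval I" and u: "smooth_upto I 7 u" and pde: "pde_solution \<delta> I u"
  obtains K \<mu> where "0 < K" "0 < \<mu>"
    "\<And>N \<tau> k i. 0 < \<tau> \<Longrightarrow> real (Suc k) * \<tau> \<in> I \<Longrightarrow> i < N \<Longrightarrow>
        \<bar>dvd_residual \<delta> N \<tau> (\<lambda>j. sqrt (grid_values N \<tau> u k j))
                            (\<lambda>j. sqrt (grid_values N \<tau> u (Suc k) j)) i\<bar>
        \<le> K * exp (- \<mu> * (real k * \<tau>)) * (\<tau> + (mesh N)\<^sup>2)"
proof -
  obtain \<epsilon> c C \<mu> where \<epsilon>: "0 < \<epsilon>" "\<And>t x. t \<in> I \<Longrightarrow> \<epsilon> \<le> sqrt (u t x)" and C: "0 \<le> C" "0 < \<mu>"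
    and le: "derivs_le I (\<lambda>t. C * exp (- \<mu> * t)) 6 (\<lambda>t x. sqrt (u t x) - c)"
    by (rule sqrt_solution_regularity[OF I u pde]) (rule that)
  define B where "B = (\<lambda>t. C * exp (- \<mu> * t))"
  define v where "v = (\<lambda>t x. sqrt (u t x))"
  define f where "f = (\<lambda>t x. v t x - c)"
  have le: "derivs_le I B 6 f" using le by (simp only: B_def f_def v_def)
  have six: "6 = Suc (Suc 4)" by simp
  obtain ft fx where ft: "\<And>t x. t \<in> I \<Longrightarrow> ((\<lambda>s. f s x) has_real_derivative ft t x) (at t within I)"
    "\<And>t x. t \<in> I \<Longrightarrow> (f t has_real_derivative fx t x) (at x)"
    "derivs_le I B (Suc 4) ft" "derivs_le I B (Suc 4) fx"
    using le[unfolded six] by (rule derivs_le_SucE) (rule that)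
  obtain ftt ftx where ftt: "\<And>t x. t \<in> I \<Longrightarrow> ((\<lambda>s. ft s x) has_real_derivative ftt t x) (at t within I)"
    "\<And>t x. t \<in> I \<Longrightarrow> (ft t has_real_derivative ftx t x) (at x)"
    "derivs_le I B 4 ftt" "derivs_le I B 4 ftx"
    using ft(3) by (rule derivs_le_SucE) (rule that)
  obtain g gt where g0: "g 0 = f"
    and g: "\<forall>j<6. \<forall>t\<in>I. \<forall>x. ((\<lambda>s. g j s x) has_real_derivative gt j t x) (at t within I) \<and>
        (g j t has_real_derivative g (Suc j) t x) (at x) \<and> \<bar>gt j t x\<bar> \<le> B t"
    and gB: "\<forall>j\<le>6. \<forall>t\<in>I. \<forall>x. \<bar>g j t x\<bar> \<le> B t"
    using derivs_le_family[OF le] by (elim exE conjE) (rule that)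
  \<comment> \<open>The decaying function is \<open>f = v - c\<close>, but the scheme acts on
    \<open>v\<close>. Only the entry of order 0 differs; derivatives and time increments are the
    same.\<close>
  define G where "G = (\<lambda>t j x. if j = 0 then v t x else g j t x)"
  have gT: "((\<lambda>s. g j s x) has_real_derivative gt j t x) (at t within I)" "\<bar>gt j t x\<bar> \<le> B t"
    and gX: "(g j t has_real_derivative g (Suc j) t x) (at x)"
    if "j < 6" "t \<in> I" for t j x
    using g that by blast+
  have G: "(G t j has_real_derivative G t l x) (at x)" if l: "l = Suc j" and j: "j < 6" and t: "t \<in> I" for t j l x
  proof (cases "j = 0")
    case True
    have "(f t has_real_derivative g l t x) (at x)"
      using gX[OF j t] by (simp add: True g0 l)
    from DERIV_add[OF this DERIV_const[of c]] show ?thesis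
      by (simp add: True G_def f_def l)
  next
    case False
    then have "G t j = g j t" "G t l = g l t" by (simp_all add: G_def l)
    then show ?thesis using gX[OF j t] by (simp add: l)
  qed
  \<comment> \<open>Everything that happens during the step from \<open>t\<close> to
    \<open>t + \<tau>\<close> is thereby bounded by \<open>B t\<close>.\<close>
  have anti: "B s \<le> B t" if "t \<le> s" for s t
    using that C by (auto simp: B_def intro!: mult_left_mono)
  define K where "K = (5 + 6 * C / \<epsilon> + C\<^sup>2 / \<epsilon>\<^sup>2 + 5 * \<bar>\<delta>\<bar>)"
  have K: "0 \<le> K" using C \<epsilon>(1) by (simp add: K_def)
  have main: "\<bar>dvd_residual \<delta> N \<tau> (\<lambda>j. v t (real j * mesh N)) (\<lambda>j. v (t + \<tau>) (real j * mesh N)) i\<bar>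
        \<le> K * B t * (\<tau> + (mesh N)\<^sup>2)"
    if \<tau>: "0 < \<tau>" and t0: "0 \<le> t" and t': "t + \<tau> \<in> I" and i: "i < N" for \<tau> t i N
  proof -
    have sub: "{t..t + \<tau>} \<subseteq> I"
      using time_intervalD(6)[OF I t'] t0 by auto
    then have t: "t \<in> I" using \<tau> by auto
    have "\<bar>dvd_residual \<delta> N \<tau> (\<lambda>j. G t 0 (real j * mesh N)) (\<lambda>j. G (t + \<tau>) 0 (real j * mesh N)) i\<bar>
        \<le> (5 + 6 * C / \<epsilon> + C\<^sup>2 / \<epsilon>\<^sup>2 + 5 * \<bar>\<delta>\<bar>) * B t * (\<tau> + (mesh N)\<^sup>2)"
    proof (rule dvd_residual_bound[where g = "G t" and g' = "G (t + \<tau>)", OF _ _ G[OF refl _ t] G[OF refl _ t'] _ _ _ \<epsilon>(1) _ _ _ _ i \<tau>])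
      show "G t 0 (x + 1) = G t 0 x" "G (t + \<tau>) 0 (x + 1) = G (t + \<tau>) 0 x" for x
        using pde_solutionD(2)[OF pde t] pde_solutionD(2)[OF pde t'] by (simp_all add: G_def v_def)
      show "\<bar>G t j x\<bar> \<le> B t" if "1 \<le> j" "j \<le> 6" for j x
        using gB[rule_format, of j t x] that t by (simp add: G_def)
      show "\<bar>G (t + \<tau>) j x\<bar> \<le> B t" if "1 \<le> j" "j \<le> 6" for j x
        using gB[rule_format, of j "t + \<tau>" x] anti[of t "t + \<tau>"] \<tau> that t' by (simp add: G_def)
      show "\<epsilon> \<le> G t 0 x" "\<epsilon> \<le> G (t + \<tau>) 0 x" for x
        using \<epsilon>(2) t t' by (simp_all add: G_def v_def)
      show "B t \<le> C"
        using anti[of 0 t] t0 by (simp add: B_def)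
      show "\<bar>G (t + \<tau>) j x - G t j x\<bar> \<le> B t * \<tau>" if "j \<le> 4" for j x
      proof -
        have "norm (g j (t + \<tau>) x - g j t x) \<le> B t * norm (t + \<tau> - t)"
        proof (rule field_differentiable_bound[of "{t..t + \<tau>}" "\<lambda>s. g j s x" "\<lambda>s. gt j s x"])
          fix s assume s: "s \<in> {t..t + \<tau>}"
          have "s \<in> I" using s sub by blast
          have j: "j < 6" using that by simp
          show "((\<lambda>s. g j s x) has_real_derivative gt j s x) (at s within {t..t + \<tau>})"
            by (rule DERIV_subset[OF gT(1)[OF j \<open>s \<in> I\<close>] sub])
          have "B s \<le> B t" using s by (intro anti) simp
          then show "norm (gt j s x) \<le> B t"
            using gT(2)[OF j \<open>s \<in> I\<close>, of x] by simp
        qed (use \<tau> in auto)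
        then show ?thesis
          using \<tau> by (cases "j = 0") (simp_all add: G_def g0 f_def)
      qed
      show "\<bar>(G (t + \<tau>) 0 x - G t 0 x) / \<tau> -
          (- 1/2 * G t 4 x + (G t 2 x)\<^sup>2 / (2 * G t 0 x) + \<delta> / 2 * G t 3 x)\<bar> \<le> B t * \<tau>" for x
      proof -
        have vt: "((\<lambda>s. v s x) has_real_derivative ft t x) (at t within I)"
          using DERIV_add[OF ft(1)[OF t, of x] DERIV_const[of c]] by (simp add: f_def)
        have "G t 0 = v t" by (rule ext) (simp add: G_def)
        then have Gd: "\<And>x. (v t has_real_derivative G t 1 x) (at x)" "\<And>x. (G t 1 has_real_derivative G t 2 x) (at x)"
          "\<And>x. (G t 2 has_real_derivative G t 3 x) (at x)" "\<And>x. (G t 3 has_real_derivative G t 4 x) (at x)"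
          using G[of 1 0 t] by (simp_all add: t G)
        have "ft t x = - 1/2 * G t 4 x + (G t 2 x)\<^sup>2 / (2 * sqrt (u t x)) + \<delta> / 2 * G t 3 x"
          by (rule pde_solution_sqrt[OF I pde t vt[unfolded v_def] Gd[unfolded v_def]])
        then have "ft t x = - 1/2 * G t 4 x + (G t 2 x)\<^sup>2 / (2 * G t 0 x) + \<delta> / 2 * G t 3 x"
          by (simp add: G_def v_def)
        moreover have "\<bar>f (t + \<tau>) x - f t x - (t + \<tau> - t) * ft t x\<bar> \<le> B t * (t + \<tau> - t)\<^sup>2"
        proof (rule taylor1_bound[OF time_intervalD(1)[OF I] t t' _ ft(1) ftt(1)])
          show "\<bar>ftt s x\<bar> \<le> B t" if "s \<in> I" "t \<le> s" for s
            using derivs_leD[OF ftt(3) that(1), of x] anti[OF that(2)] by simp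
        qed (use \<tau> in auto)
        then have "\<bar>v (t + \<tau>) x - v t x - \<tau> * ft t x\<bar> \<le> (B t * \<tau>) * \<tau>"
          by (simp add: f_def power2_eq_square mult.assoc)
        then have "\<bar>v (t + \<tau>) x - v t x - \<tau> * ft t x\<bar> / \<tau> \<le> B t * \<tau>"
          using \<tau> by (simp add: divide_le_eq)
        moreover have "(v (t + \<tau>) x - v t x) / \<tau> - ft t x = (v (t + \<tau>) x - v t x - \<tau> * ft t x) / \<tau>"
          using \<tau> by (simp add: field_simps)
        ultimately show ?thesis
          using \<tau> by (simp add: G_def abs_divide)
      qed
    qed
    then show ?thesis by (simp add: G_def K_def)
  qed
  show thesis
  \<comment> \<open>\<open>C\<close> may be zero, whereas a positive constant is promised.\<close>
  proof (rule that[of "K * C + 1" \<mu>])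
    show "0 < K * C + 1" using K C by (simp add: add_nonneg_pos)
    fix N :: nat and \<tau> :: real and k i :: nat
    assume a: "0 < \<tau>" "real (Suc k) * \<tau> \<in> I" "i < N"
    have "\<bar>dvd_residual \<delta> N \<tau> (\<lambda>j. v (real k * \<tau>) (real j * mesh N)) (\<lambda>j. v (real k * \<tau> + \<tau>) (real j * mesh N)) i\<bar>
        \<le> K * B (real k * \<tau>) * (\<tau> + (mesh N)\<^sup>2)"
      by (rule main) (use a in \<open>simp_all add: algebra_simps\<close>)
    also have "\<dots> = (K * C) * (exp (- \<mu> * (real k * \<tau>)) * (\<tau> + (mesh N)\<^sup>2))"
      by (simp add: B_def)
    also have "\<dots> \<le> (K * C + 1) * (exp (- \<mu> * (real k * \<tau>)) * (\<tau> + (mesh N)\<^sup>2))"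
      using a(1) by (intro mult_right_mono) auto
    finally show "\<bar>dvd_residual \<delta> N \<tau> (\<lambda>j. sqrt (grid_values N \<tau> u k j))
        (\<lambda>j. sqrt (grid_values N \<tau> u (Suc k) j)) i\<bar>
        \<le> (K * C + 1) * exp (- \<mu> * (real k * \<tau>)) * (\<tau> + (mesh N)\<^sup>2)"
      by (simp add: grid_values_def v_def algebra_simps)
  qed (rule C)
qed

lemma pde_solution_consistent:
  fixes u :: "real \<Rightarrow> real \<Rightarrow> real"
  assumes I: "time_interval I" and u: "smooth_upto I 7 u" and pde: "pde_solution \<delta> I u"
  shows "consistent \<delta> I u"
proof -
  obtain K \<mu> where K: "0 < K" "0 < \<mu>"
    and r: "\<And>N \<tau> k i. 0 < \<tau> \<Longrightarrow> real (Suc k) * \<tau> \<in> I \<Longrightarrow> i < N \<Longrightarrow>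
        \<bar>dvd_residual \<delta> N \<tau> (\<lambda>j. sqrt (grid_values N \<tau> u k j))
                            (\<lambda>j. sqrt (grid_values N \<tau> u (Suc k) j)) i\<bar>
        \<le> K * exp (- \<mu> * (real k * \<tau>)) * (\<tau> + (mesh N)\<^sup>2)"
    by (rule consistency_with_decay[OF I u pde]) (rule that)
  have le: "K * exp (- \<mu> * (real k * \<tau>)) * (\<tau> + (mesh N)\<^sup>2) \<le> K * (\<tau> + (mesh N)\<^sup>2)" if "0 < \<tau>" for \<tau> k N
  proof -
    have "K * exp (- \<mu> * (real k * \<tau>)) \<le> K * 1"
      using K that by (intro mult_left_mono) auto
    then show ?thesis using that by (intro mult_right_mono) auto
  qed
  show ?thesis
    unfolding consistent_def
    by (rule exI[of _ K]) (intro conjI K(1) allI impI order_trans[OF r le]; assumption)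
qed

section \<open>Accumulation of the local errors\<close>

lemma L2_set_le_sqrt_card:
  assumes "\<And>i. i \<in> A \<Longrightarrow> \<bar>f i\<bar> \<le> b" "0 \<le> b"
  shows "L2_set f A \<le> sqrt (real (card A)) * b"
proof -
  have "(\<Sum>i\<in>A. (f i)\<^sup>2) \<le> (\<Sum>i\<in>A. b\<^sup>2)"
    using assms abs_le_square_iff[of _ b] by (intro sum_mono) auto
  then have "L2_set f A \<le> sqrt (real (card A) * b\<^sup>2)"
    unfolding L2_set_def by (intro real_sqrt_le_mono) simp
  then show ?thesis using assms(2) by (simp add: real_sqrt_mult)
qed

text \<open>The error recursion adds up a geometric series of ratio
  \<open>q = exp (- \<mu> * \<tau>)\<close>. The induction carries the closed form
  \<open>D * (1 - q ^ j)\<close> of its partial sums.\<close>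

lemma dvd_error_accumulation:
  assumes sol: "dvd_solution \<delta> N \<tau> U V" and \<tau>: "0 < \<tau>" "\<tau> < 1" and \<mu>: "0 < \<mu>" and b: "0 \<le> b"
    and v: "\<And>j i. j \<le> k \<Longrightarrow> i < N \<Longrightarrow> 0 < v j i"
    and r: "\<And>j i. j < k \<Longrightarrow> i < N \<Longrightarrow> \<bar>dvd_residual \<delta> N \<tau> (v j) (v (Suc j)) i\<bar> \<le> exp (- \<mu> * (real j * \<tau>)) * b"
  shows "L2_set (\<lambda>i. v k i - V k i) {..<N} \<le> L2_set (\<lambda>i. v 0 i - V 0 i) {..<N} + sqrt (real N) * b * ((1 + \<mu>) / \<mu>)"
proof -
  define q where "q = exp (- \<mu> * \<tau>)"
  define D where "D = sqrt (real N) * b * ((1 + \<mu>) / \<mu>)"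
  have q: "0 < q" "q \<le> 1" using \<mu> \<tau> by (auto simp: q_def)
  have qj: "exp (- \<mu> * (real j * \<tau>)) = q ^ j" for j
    by (simp add: q_def mult_ac flip: exp_of_nat_mult)
  \<comment> \<open>\<open>\<tau> / (1 - q)\<close> is the value of the full series. It is bounded
    through \<open>1 + x \<le> exp x\<close> at \<open>x = \<mu> * \<tau>\<close>, and
    \<open>\<tau> < 1\<close> makes the bound independent of \<open>\<tau>\<close>.\<close>
  have gap: "\<tau> \<le> (1 - q) * ((1 + \<mu>) / \<mu>)"
  proof -
    have "1 + \<mu> * \<tau> \<le> exp (\<mu> * \<tau>)" by (rule exp_ge_add_one_self)
    then have "q * (1 + \<mu> * \<tau>) \<le> q * exp (\<mu> * \<tau>)" using q by (intro mult_left_mono) auto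
    also have "\<dots> = 1" by (simp add: q_def flip: exp_add)
    finally have "\<mu> * \<tau> \<le> (1 - q) * (1 + \<mu> * \<tau>)" by (simp add: algebra_simps)
    also have "\<dots> \<le> (1 - q) * (1 + \<mu>)" using q \<mu> \<tau> by (intro mult_left_mono) auto
    finally show ?thesis using \<mu> by (simp add: field_simps)
  qed
  have "L2_set (\<lambda>i. v j i - V j i) {..<N} \<le> L2_set (\<lambda>i. v 0 i - V 0 i) {..<N} + D * (1 - q ^ j)"
    if "j \<le> k" for j
    using that
  proof (induction j)
    case (Suc j)
    have "L2_set (\<lambda>i. v (Suc j) i - V (Suc j) i) {..<N}
        \<le> L2_set (\<lambda>i. v j i - V j i) {..<N} + \<tau> * L2_set (dvd_residual \<delta> N \<tau> (v j) (v (Suc j))) {..<N}"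
    proof (rule dvd_error_step)
      show "0 < midpoint (V j) (V (Suc j)) i" "dvd_residual \<delta> N \<tau> (V j) (V (Suc j)) i = 0" if "i < N" for i
        using dvd_solutionD(4,5)[OF sol that, of j] by (simp_all add: dvd_residual_def)
      show "0 < midpoint (v j) (v (Suc j)) i" if "i < N" for i
        using v[of j i] v[of "Suc j" i] Suc.prems that by (simp add: midpoint_def)
    qed (rule \<tau>)
    also have "\<dots> \<le> (L2_set (\<lambda>i. v 0 i - V 0 i) {..<N} + D * (1 - q ^ j)) + D * (q ^ j * (1 - q))"
    proof (rule add_mono)
      have "L2_set (dvd_residual \<delta> N \<tau> (v j) (v (Suc j))) {..<N} \<le> sqrt (real (card {..<N})) * (q ^ j * b)"
        using r[of j, unfolded qj] Suc.prems q b by (intro L2_set_le_sqrt_card) auto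
      then have "\<tau> * L2_set (dvd_residual \<delta> N \<tau> (v j) (v (Suc j))) {..<N} \<le> \<tau> * (sqrt (real N) * (q ^ j * b))"
        using \<tau> by (intro mult_left_mono) auto
      also have "\<dots> \<le> ((1 - q) * ((1 + \<mu>) / \<mu>)) * (sqrt (real N) * (q ^ j * b))"
        using gap q b by (intro mult_right_mono) auto
      finally show "\<tau> * L2_set (dvd_residual \<delta> N \<tau> (v j) (v (Suc j))) {..<N} \<le> D * (q ^ j * (1 - q))"
        by (simp add: D_def mult_ac)
    qed (use Suc in simp)
    also have "\<dots> = L2_set (\<lambda>i. v 0 i - V 0 i) {..<N} + D * (1 - q ^ Suc j)"
      by (simp add: algebra_simps)
    finally show ?case .
  qed simp
  from this[of k] have "L2_set (\<lambda>i. v k i - V k i) {..<N} \<le> L2_set (\<lambda>i. v 0 i - V 0 i) {..<N} + D * (1 - q ^ k)"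
    by simp
  also have "D * (1 - q ^ k) \<le> D * 1"
    using q b \<mu> by (intro mult_left_mono) (auto simp: D_def)
  finally show ?thesis by (simp add: D_def)
qed

lemma power2_sum_le: "(a + b)\<^sup>2 \<le> 2 * a\<^sup>2 + 2 * (b::real)\<^sup>2"
  using zero_le_power2[of "a - b"] by (simp add: power2_eq_square algebra_simps)

text \<open>The estimate is obtained with \<open>Q\<close> in place of
  \<open>Q / (1 - \<tau>)\<close>, which is the larger of the two. The factor
  \<open>sqrt (real N)\<close> from the sum over the grid is compensated by the weight
  \<open>mesh N\<close> in the distance.\<close>

lemma dvd_convergence:
  fixes u :: "real \<Rightarrow> real \<Rightarrow> real"
  assumes I: "time_interval I" and u: "smooth_upto I 7 u" and pde: "pde_solution \<delta> I u" and C0: "0 \<le> C0"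
  shows "\<exists>C>0. \<forall>(N::nat) (\<tau>::real) U V.
     0 < N \<longrightarrow> 0 < \<tau> \<longrightarrow> \<tau> < 1 \<longrightarrow> initial_datum N (U 0) \<longrightarrow> dvd_solution \<delta> N \<tau> U V \<longrightarrow>
     dhellinger2 N (grid_values N \<tau> u 0) (U 0) \<le> C0 * (\<tau>\<^sup>2 + (mesh N)^4) \<longrightarrow>
     (\<forall>k\<ge>1. real k * \<tau> \<in> I \<longrightarrow>
        dhellinger2 N (grid_values N \<tau> u k) (U k) \<le> C * ((\<tau>\<^sup>2 + (mesh N)^4) / (1 - \<tau>)))"
proof -
  obtain K \<mu> where K: "0 < K" "0 < \<mu>"
    and r: "\<And>N \<tau> k i. 0 < \<tau> \<Longrightarrow> real (Suc k) * \<tau> \<in> I \<Longrightarrow> i < N \<Longrightarrow>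
        \<bar>dvd_residual \<delta> N \<tau> (\<lambda>j. sqrt (grid_values N \<tau> u k j))
                            (\<lambda>j. sqrt (grid_values N \<tau> u (Suc k) j)) i\<bar>
        \<le> K * exp (- \<mu> * (real k * \<tau>)) * (\<tau> + (mesh N)\<^sup>2)"
    by (rule consistency_with_decay[OF I u pde]) (rule that)
  define S where "S = K * ((1 + \<mu>) / \<mu>)"
  \<comment> \<open>Squaring the sum of initial and accumulated error gives a factor 2, and
    \<open>(\<tau> + h\<^sup>2)\<^sup>2 \<le> 2 (\<tau>\<^sup>2 + h^4)\<close> another one for the
    latter; the 1 ensures positivity.\<close>
  define C where "C = 2 * C0 + 4 * S\<^sup>2 + 1"
  show ?thesis
  proof (intro exI[of _ C] conjI allI impI)
    show "0 < C" using C0 by (simp add: C_def add_nonneg_pos)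
    fix N :: nat and \<tau> :: real and U V :: "nat \<Rightarrow> nat \<Rightarrow> real" and k :: nat
    assume N: "0 < N" and \<tau>: "0 < \<tau>" "\<tau> < 1" and sol: "dvd_solution \<delta> N \<tau> U V"
      and init: "dhellinger2 N (grid_values N \<tau> u 0) (U 0) \<le> C0 * (\<tau>\<^sup>2 + (mesh N)^4)"
      and k: "real k * \<tau> \<in> I"
    define v where "v = (\<lambda>j i. sqrt (grid_values N \<tau> u j i))"
    define n where "n = (\<lambda>j. L2_set (\<lambda>i. v j i - V j i) {..<N})"
    define Q where "Q = \<tau>\<^sup>2 + (mesh N)^4"
    have Q: "0 \<le> Q" by (simp add: Q_def)
    have h: "0 < mesh N" "mesh N * real N = 1" using N by (auto simp: mesh_def)
    have jI: "real j * \<tau> \<in> I" if "j \<le> k" for j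
      using time_intervalD(6)[OF I k, of "real j * \<tau>"] \<tau> that by (simp add: mult_right_mono)
    have dh: "dhellinger2 N (grid_values N \<tau> u j) (U j) = mesh N * (n j)\<^sup>2" for j
      unfolding n_def by (rule dhellinger2_eq) (use dvd_solutionD(3)[OF sol] in \<open>auto simp: v_def\<close>)
    have "n k \<le> n 0 + sqrt (real N) * (K * (\<tau> + (mesh N)\<^sup>2)) * ((1 + \<mu>) / \<mu>)"
      unfolding n_def
    proof (rule dvd_error_accumulation[OF sol \<tau> K(2)])
      show "0 < v j i" if "j \<le> k" for j i
        using pde_solutionD(1)[OF pde jI[OF that]] by (simp add: v_def grid_values_def)
      show "\<bar>dvd_residual \<delta> N \<tau> (v j) (v (Suc j)) i\<bar> \<le> exp (- \<mu> * (real j * \<tau>)) * (K * (\<tau> + (mesh N)\<^sup>2))"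
        if "j < k" "i < N" for j i
        using r[OF \<tau>(1) jI[of "Suc j"] that(2)] that(1) unfolding v_def by (simp add: mult_ac)
    qed (use K \<tau> in simp)
    then have "(n k)\<^sup>2 \<le> (n 0 + sqrt (real N) * (S * (\<tau> + (mesh N)\<^sup>2)))\<^sup>2"
      by (intro power_mono) (auto simp: n_def S_def mult_ac)
    also have "\<dots> \<le> 2 * (n 0)\<^sup>2 + 2 * (sqrt (real N) * (S * (\<tau> + (mesh N)\<^sup>2)))\<^sup>2"
      by (rule power2_sum_le)
    also have "\<dots> = 2 * (n 0)\<^sup>2 + real N * (2 * S\<^sup>2 * (\<tau> + (mesh N)\<^sup>2)\<^sup>2)"
      by (simp add: power_mult_distrib)
    finally have "mesh N * (n k)\<^sup>2 \<le> mesh N * (2 * (n 0)\<^sup>2 + real N * (2 * S\<^sup>2 * (\<tau> + (mesh N)\<^sup>2)\<^sup>2))"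
      using h(1) by (intro mult_left_mono) auto
    also have "\<dots> = 2 * (mesh N * (n 0)\<^sup>2) + 2 * S\<^sup>2 * (\<tau> + (mesh N)\<^sup>2)\<^sup>2"
      using h(2) by (simp add: distrib_left flip: mult.assoc)
    also have "\<dots> \<le> 2 * (C0 * Q) + 2 * S\<^sup>2 * (2 * Q)"
    proof (intro add_mono mult_left_mono)
      show "mesh N * (n 0)\<^sup>2 \<le> C0 * Q" using init unfolding dh Q_def .
      show "(\<tau> + (mesh N)\<^sup>2)\<^sup>2 \<le> 2 * Q"
        using power2_sum_le[of \<tau> "(mesh N)\<^sup>2"] by (simp add: Q_def flip: power_mult)
    qed auto
    also have "\<dots> \<le> C * Q" using Q by (simp add: C_def algebra_simps)
    also have "\<dots> \<le> C * (Q / (1 - \<tau>))"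
    proof (rule mult_left_mono)
      show "Q \<le> Q / (1 - \<tau>)"
        using \<tau> Q by (simp add: le_divide_eq mult_left_le)
    qed (use \<open>0 < C\<close> in simp)
    finally show "dhellinger2 N (grid_values N \<tau> u k) (U k) \<le> C * ((\<tau>\<^sup>2 + (mesh N)^4) / (1 - \<tau>))"
      unfolding dh Q_def .
  qed
qed

lemma dvd_scheme_invariants:
  assumes \<tau>: "0 < \<tau>" and init: "initial_datum N (U 0)" and sol: "dvd_solution \<delta> N \<tau> U V"
  shows "(\<forall>k\<ge>1. (\<forall>i<N. 0 \<le> U k i) \<and> dmass N (U k) = 1) \<and> (\<forall>k. dfisher N (U (Suc k)) \<le> dfisher N (U k))"
proof -
  have "dmass N (U k) = 1" for k
    by (induction k) (use init in \<open>simp_all add: initial_datum_def dmass_step[OF sol \<tau>]\<close>)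
  moreover have "0 \<le> U k i" if "i < N" for k i
    using dvd_solutionD(2)[OF sol that, of k] by (metis zero_le_power2)
  ultimately show ?thesis
    using dfisher_step[OF sol \<tau>] by blast
qed

theorem theorem1p3:
  shows "(\<forall>(\<delta>::real) (N::nat) (\<tau>::real) U V.
            0 < N \<longrightarrow> 0 < \<tau> \<longrightarrow> initial_datum N (U 0) \<longrightarrow> dvd_solution \<delta> N \<tau> U V \<longrightarrow>
              (\<forall>k\<ge>1. (\<forall>i<N. 0 \<le> U k i) \<and> dmass N (U k) = 1) \<and>
              (\<forall>k. dfisher N (U (Suc k)) \<le> dfisher N (U k)))
       \<and> (\<exists>m::nat. \<forall>(\<delta>::real) I u.
            time_interval I \<longrightarrow> smooth_upto I m u \<longrightarrow> pde_solution \<delta> I u \<longrightarrow>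
              consistent \<delta> I u \<and>
              (\<forall>C0\<ge>0. \<exists>C>0. \<forall>(N::nat) (\<tau>::real) U V.
                 0 < N \<longrightarrow> 0 < \<tau> \<longrightarrow> \<tau> < 1 \<longrightarrow>
                 initial_datum N (U 0) \<longrightarrow> dvd_solution \<delta> N \<tau> U V \<longrightarrow>
                 dhellinger2 N (grid_values N \<tau> u 0) (U 0) \<le> C0 * (\<tau>\<^sup>2 + (mesh N)^4) \<longrightarrow>
                 (\<forall>k\<ge>1. real k * \<tau> \<in> I \<longrightarrow>
                    dhellinger2 N (grid_values N \<tau> u k) (U k)
                      \<le> C * ((\<tau>\<^sup>2 + (mesh N)^4) / (1 - \<tau>)))))"
proof (rule conjI, intro allI impI, goal_cases)
  case (1 \<delta> N \<tau> U V)
  show ?case by (rule dvd_scheme_invariants[OF 1(2-4)])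
next
  case 2
  show ?case
  \<comment> \<open>Six orders for the truncation error of the nested second difference, and one
    more that \<open>smooth_upto_decay\<close> loses.\<close>
  proof (rule exI[of _ 7], intro allI impI, goal_cases)
    case (1 \<delta> I u)
    show ?case
    proof (intro conjI allI impI)
      show "consistent \<delta> I u" by (rule pde_solution_consistent[OF 1])
    qed (rule dvd_convergence[OF 1])
  qed
qed

end
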